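(* Let $1\le r\le s\le t$ and $n=r+s+t+1$. Then $$n+3=r+s+t+4\le D^{f}_{2r+1}(E3C(r,s,t))\le D_{2r+2}(E3C(r,s,t))\le r+s+t+6=n+5.$$
   Context: The exchanged 3-ary $n$-cube $E3C(r,s,t)$ ($r,s,t\ge1$, $n=r+s+t+1$): vertices are strings written $x=ABCd$ with $A\in\{0,1,2\}^r$, $B\in\{0,1,2\}^s$, $C\in\{0,1,2\}^t$, $d\in\{0,1,2\}$. Two distinct vertices $x=ABCd$, $y=A'B'C'd'$ are adjacent iff one of: (E0) $A=A',B=B',C=C'$ and $d\ne d'$; (E1) $d=d'=0$, $A=A'$, $B=B'$ and $C,C'$ differ in exactly one position; (E2) $d=d'=1$, $A=A'$, $C=C'$ and $B,B'$ differ in exactly one position; (E3) $d=d'=2$, $B=B'$, $C=C'$ and $A,A'$ differ in exactly one position. For a connected graph $G$ with vertex connectivity $\kappa(G)$: the $\alpha$-fault diameter ($1\le\alpha\le\kappa(G)-1$) is $D^f_\alpha(G)=\max\{d_{G-F}(u,v): u\ne v,\ F\subseteq V(G)\setminus\{u,v\},\ |F|=\alpha\}$; the $\beta$-wide diameter ($1\le\beta\le\kappa(G)$) $D_\beta(G)$ is the maximum over distinct $u,v$ of the minimum, over all families of $\beta$ pairwise internally disjoint $u$–$v$ paths, of the maximum length of a path in the family. (It is known that $\kappa(E3C(r,s,t))=2r+2$ when $r\le s\le t$.) *)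

theory Defs
  imports Main "HOL-Library.Extended_Nat"
begin

definition gpath :: "'a set \<Rightarrow> ('a \<Rightarrow> 'a \<Rightarrow> bool) \<Rightarrow> 'a list \<Rightarrow> 'a \<Rightarrow> 'a \<Rightarrow> bool" where
  "gpath V E p u v \<longleftrightarrow> p \<noteq> [] \<and> hd p = u \<and> last p = v \<and> distinct p \<and> set p \<subseteq> V \<and>
      (\<forall>i. i + 1 < length p \<longrightarrow> E (p ! i) (p ! (i + 1)))"

definition plen :: "'a list \<Rightarrow> nat" where
  "plen p = length p - 1"

text \<open>Distance in the subgraph induced by V (infinite if no path).\<close>
definition gdist :: "'a set \<Rightarrow> ('a \<Rightarrow> 'a \<Rightarrow> bool) \<Rightarrow> 'a \<Rightarrow> 'a \<Rightarrow> enat" where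
  "gdist V E u v = Inf {enat (plen p) | p. gpath V E p u v}"

definition fault_diam :: "'a set \<Rightarrow> ('a \<Rightarrow> 'a \<Rightarrow> bool) \<Rightarrow> nat \<Rightarrow> enat" where
  "fault_diam V E \<alpha> = Sup {gdist (V - F) E u v | u v F.
      u \<in> V \<and> v \<in> V \<and> u \<noteq> v \<and> F \<subseteq> V - {u, v} \<and> finite F \<and> card F = \<alpha>}"

definition disj_paths :: "'a set \<Rightarrow> ('a \<Rightarrow> 'a \<Rightarrow> bool) \<Rightarrow> nat \<Rightarrow> 'a \<Rightarrow> 'a \<Rightarrow> 'a list set \<Rightarrow> bool" where
  "disj_paths V E \<beta> u v P \<longleftrightarrow> finite P \<and> card P = \<beta> \<and> (\<forall>p\<in>P. gpath V E p u v) \<and>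
      (\<forall>p\<in>P. \<forall>q\<in>P. p \<noteq> q \<longrightarrow> set p \<inter> set q \<subseteq> {u, v})"

definition wide_diam :: "'a set \<Rightarrow> ('a \<Rightarrow> 'a \<Rightarrow> bool) \<Rightarrow> nat \<Rightarrow> enat" where
  "wide_diam V E \<beta> = Sup {Inf {Sup ((\<lambda>p. enat (plen p)) ` P) | P. disj_paths V E \<beta> u v P} | u v.
      u \<in> V \<and> v \<in> V \<and> u \<noteq> v}"

definition tern_words :: "nat \<Rightarrow> nat list set" where
  "tern_words k = {xs. length xs = k \<and> set xs \<subseteq> {0, 1, 2}}"

text \<open>Vertex ABCd is represented as the tuple (A, B, C, d).\<close>
type_synonym e3c_vertex = "nat list \<times> nat list \<times> nat list \<times> nat"

definition E3C_V :: "nat \<Rightarrow> nat \<Rightarrow> nat \<Rightarrow> e3c_vertex set" where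
  "E3C_V r s t = {(A, B, C, d). A \<in> tern_words r \<and> B \<in> tern_words s \<and> C \<in> tern_words t \<and> d \<in> {0, 1, 2}}"

definition differ_one :: "nat list \<Rightarrow> nat list \<Rightarrow> bool" where
  "differ_one X Y \<longleftrightarrow> length X = length Y \<and> card {i. i < length X \<and> X ! i \<noteq> Y ! i} = 1"

definition E3C_E :: "e3c_vertex \<Rightarrow> e3c_vertex \<Rightarrow> bool" where
  "E3C_E x y \<longleftrightarrow> (case (x, y) of ((A, B, C, d), (A', B', C', d')) \<Rightarrow>
      x \<noteq> y \<and>
      ((A = A' \<and> B = B' \<and> C = C' \<and> d \<noteq> d') \<or>
       (d = 0 \<and> d' = 0 \<and> A = A' \<and> B = B' \<and> differ_one C C') \<or>
       (d = 1 \<and> d' = 1 \<and> A = A' \<and> C = C' \<and> differ_one B B') \<or>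
       (d = 2 \<and> d' = 2 \<and> B = B' \<and> C = C' \<and> differ_one A A')))"

end

theory Submission
  imports
    Defs
    "HOL-Library.Disjoint_Sets"
    "HOL-Number_Theory.Cong"
    "HOL-Combinatorics.Transposition"
begin

text \<open>
  Lower bound: let \<open>u\<close> and \<open>v\<close> lie in layer 2 and differ in every position, and delete all
  neighbours of \<open>u\<close> except one, \<open>w\<close>, that also differs from \<open>v\<close> in every position. Every path
  from \<open>w\<close> to \<open>v\<close> corrects \<open>r + s + t\<close> positions and changes the layer three times.

  Middle inequality: \<open>2r + 1\<close> faults meet at most \<open>2r + 1\<close> of \<open>2r + 2\<close> internally disjoint paths.

  Upper bound: up to permuting the three words and reversing paths, \<open>u = (X, Y, Z, 2)\<close> and
  \<open>v = (X', Y', Z', d)\<close> with \<open>d\<close> 2 or 1. It suffices to confine walks to pairwise disjoint vertex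
  sets. For \<open>d = 2\<close> a walk starts at each neighbour \<open>P\<close> of \<open>X\<close>, carries \<open>P\<close> along while it
  corrects \<open>Y\<close> and then \<open>Z\<close>, and finishes in a fan of geodesics from the neighbours of \<open>X\<close> to
  \<open>X'\<close> in the Hamming graph. For \<open>d = 1\<close> neighbours \<open>P\<close> of \<open>X\<close> are matched with neighbours \<open>Q\<close>
  of \<open>Y'\<close>; a walk corrects \<open>Y\<close> to \<open>Q\<close> beside \<open>P\<close>, then \<open>Z\<close>, and then \<open>P\<close> to \<open>X'\<close> beside \<open>Q\<close>.
  The remaining one or two walks make a detour through a word that differs from both end values.
\<close>

section \<open>Paths and distances\<close>

lemma gpath_iff_successively:
  "gpath V E p u v \<longleftrightarrow>
     p \<noteq> [] \<and> hd p = u \<and> last p = v \<and> distinct p \<and> set p \<subseteq> V \<and> successively E p"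
  by (simp add: gpath_def successively_conv_nth)

lemma gpath_Cons_iff:
  "gpath V E (x # p) u v \<longleftrightarrow> x = u \<and> u \<in> V \<and> u \<notin> set p \<and>
     (if p = [] then u = v else E u (hd p) \<and> gpath V E p (hd p) v)"
  by (auto simp: gpath_iff_successively successively_Cons)

lemma gpath_subset: "gpath V E p u v \<Longrightarrow> set p \<subseteq> W \<Longrightarrow> gpath W E p u v"
  by (simp add: gpath_def)

lemma gpath_rev:
  assumes "gpath V E p u v" and "symp E"
  shows "gpath V E (rev p) v u"
proof -
  have "(\<lambda>x y. E y x) = E" using \<open>symp E\<close> by (auto simp: fun_eq_iff dest: sympD)
  then have "successively E (rev p) \<longleftrightarrow> successively E p"
    unfolding successively_rev by (rule arg_cong)
  then show ?thesis
    using assms(1) by (auto simp: gpath_iff_successively hd_rev last_rev simp del: successively_rev)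
qed

lemma gpath_map:
  assumes p: "gpath V E p u v" and "inj_on f V" and "f ` V \<subseteq> W"
    and hom: "\<And>x y. x \<in> V \<Longrightarrow> y \<in> V \<Longrightarrow> E x y \<Longrightarrow> E' (f x) (f y)"
  shows "gpath W E' (map f p) (f u) (f v)"
proof -
  have "set p \<subseteq> V" "distinct p" using p by (auto simp: gpath_def)
  then have "distinct (map f p)"
    using \<open>inj_on f V\<close> by (auto simp: distinct_map intro: inj_on_subset)
  moreover have "successively E' (map f p)" unfolding successively_map
    by (rule successively_mono[of E]) (use p \<open>set p \<subseteq> V\<close> hom in \<open>auto simp: gpath_iff_successively\<close>)
  ultimately show ?thesis
    using p \<open>set p \<subseteq> V\<close> \<open>f ` V \<subseteq> W\<close> by (auto simp: gpath_iff_successively hd_map last_map)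
qed

lemma plen_map [simp]: "plen (map f p) = plen p"
  by (simp add: plen_def)

lemma plen_Cons [simp]: "p \<noteq> [] \<Longrightarrow> plen (x # p) = Suc (plen p)"
  by (cases p) (simp_all add: plen_def)

lemma plen_rev [simp]: "plen (rev p) = plen p"
  by (simp add: plen_def)

lemma gdist_le_iff: "gdist V E u v \<le> enat k \<longleftrightarrow> (\<exists>p. gpath V E p u v \<and> plen p \<le> k)"
proof
  let ?L = "{enat (plen p) | p. gpath V E p u v}"
  assume dist_le: "gdist V E u v \<le> enat k"
  have "?L \<noteq> {}"
  proof
    assume "?L = {}"
    then have "gdist V E u v = \<infinity>" unfolding gdist_def by (simp only: Inf_empty top_enat_def)
    then show False using dist_le by simp
  qed
  then obtain d where "d \<in> ?L" by blast
  then have "gdist V E u v \<in> ?L" unfolding gdist_def by (rule wellorder_InfI)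
  then show "\<exists>p. gpath V E p u v \<and> plen p \<le> k" using dist_le by auto
next
  assume "\<exists>p. gpath V E p u v \<and> plen p \<le> k"
  then obtain p where "gpath V E p u v" "plen p \<le> k" by blast
  then have "gdist V E u v \<le> enat (plen p)" unfolding gdist_def by (auto intro: Inf_lower)
  then show "gdist V E u v \<le> enat k" using \<open>plen p \<le> k\<close> by (simp add: order_trans)
qed

lemma le_gdist_iff: "enat k \<le> gdist V E u v \<longleftrightarrow> (\<forall>p. gpath V E p u v \<longrightarrow> k \<le> plen p)"
  by (auto simp: gdist_def le_Inf_iff)

lemma gdist_le_mono: "gdist V E u v \<le> enat k \<Longrightarrow> V \<subseteq> W \<Longrightarrow> k \<le> l \<Longrightarrow> gdist W E u v \<le> enat l"
  unfolding gdist_le_iff by (meson gpath_subset gpath_def order_trans)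

lemma gdist_refl: "u \<in> V \<Longrightarrow> gdist V E u u \<le> enat k"
  unfolding gdist_le_iff by (intro exI[of _ "[u]"]) (simp add: gpath_def plen_def)

lemma gdist_le_Suc:
  assumes "u \<in> V" "E u w" "gdist V E w v \<le> enat k"
  shows "gdist V E u v \<le> enat (Suc k)"
proof -
  obtain p where p: "gpath V E p w v" "plen p \<le> k" using assms(3) by (auto simp: gdist_le_iff)
  show ?thesis
  proof (cases "u \<in> set p")
    case True
    then obtain xs ys where "p = xs @ u # ys" by (metis split_list)
    with p have "gpath V E (u # ys) u v" "plen (u # ys) \<le> Suc k"
      by (auto simp: gpath_iff_successively successively_append_iff plen_def)
    then show ?thesis unfolding gdist_le_iff by blast
  next
    case False
    then have "gpath V E (u # p) u v" "plen (u # p) \<le> Suc k"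
      using p assms(1,2) by (auto simp: gpath_Cons_iff plen_def) (auto simp: gpath_def)
    then show ?thesis unfolding gdist_le_iff by blast
  qed
qed

lemma gdist_edge: "u \<in> V \<Longrightarrow> v \<in> V \<Longrightarrow> E u v \<Longrightarrow> 0 < k \<Longrightarrow> gdist V E u v \<le> enat k"
  using gdist_le_Suc[OF _ _ gdist_refl, of u V E v "k - 1"] by simp

lemma gdist_le_trans [trans]:
  assumes "gdist V E u v \<le> enat k" "gdist V E v w \<le> enat l"
  shows "gdist V E u w \<le> enat (k + l)"
proof -
  have "gdist V E u w \<le> enat (plen p + l)" if "gpath V E p u v" for p
    using that
  proof (induction p arbitrary: u)
    case (Cons x p)
    show ?case
    proof (cases "p = []")
      case True
      then show ?thesis using Cons.prems assms(2) by (simp add: gpath_Cons_iff plen_def)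
    next
      case False
      then have "gdist V E (hd p) w \<le> enat (plen p + l)" "u \<in> V" "E u (hd p)"
        using Cons by (auto simp: gpath_Cons_iff)
      then have "gdist V E u w \<le> enat (Suc (plen p + l))" by (rule gdist_le_Suc[rotated 2])
      then show ?thesis using False by simp
    qed
  qed (simp add: gpath_def)
  moreover obtain p where "gpath V E p u v" "plen p \<le> k" using assms(1) by (auto simp: gdist_le_iff)
  ultimately show ?thesis by (meson add_le_mono1 enat_ord_simps(1) order_trans)
qed

lemma gdist_map:
  assumes "gdist V E u v \<le> enat k" and "inj_on f V" and "f ` V \<subseteq> W"
    and "\<And>x y. x \<in> V \<Longrightarrow> y \<in> V \<Longrightarrow> E x y \<Longrightarrow> E' (f x) (f y)"
  shows "gdist W E' (f u) (f v) \<le> enat k"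
  using assms(1) gpath_map[of V E _ u v f W E', OF _ assms(2-4)] unfolding gdist_le_iff by fastforce

lemma gdist_ge_potential:
  fixes h :: "'a \<Rightarrow> nat"
  assumes lipschitz: "\<And>x y. x \<in> V \<Longrightarrow> y \<in> V \<Longrightarrow> E x y \<Longrightarrow> h x \<le> h y + 1"
  shows "enat (h u - h v) \<le> gdist V E u v"
proof -
  have "h u \<le> h v + plen p" if "gpath V E p u v" for p
    using that
  proof (induction p arbitrary: u)
    case (Cons x p)
    show ?case
    proof (cases "p = []")
      case False
      then have "gpath V E p (hd p) v" "x = u" "u \<in> V" "E u (hd p)"
        using Cons.prems by (auto simp: gpath_Cons_iff)
      moreover from this have "hd p \<in> V" by (auto simp: gpath_def)
      ultimately have "h (hd p) \<le> h v + plen p" "h u \<le> h (hd p) + 1"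
        using Cons.IH lipschitz by auto
      then show ?thesis using False by simp
    qed (use Cons.prems in \<open>simp add: gpath_Cons_iff\<close>)
  qed (simp add: gpath_def)
  then show ?thesis unfolding le_gdist_iff by (simp add: le_diff_conv add.commute)
qed

definition neighbours :: "'a set \<Rightarrow> ('a \<Rightarrow> 'a \<Rightarrow> bool) \<Rightarrow> 'a \<Rightarrow> 'a set" where
  "neighbours V E u = {w \<in> V. E u w}"

lemma gdist_isolated_except:
  assumes "u \<noteq> v" and "enat k \<le> gdist V E w v"
  shows "enat (Suc k) \<le> gdist (V - (neighbours V E u - {w})) E u v"
  unfolding le_gdist_iff
proof (intro allI impI)
  let ?W = "V - (neighbours V E u - {w})"
  fix p assume p: "gpath ?W E p u v"
  then obtain q where q: "p = u # q" by (cases p) (auto simp: gpath_def)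
  have "q \<noteq> []" "E u (hd q)" "gpath ?W E q (hd q) v"
    using p \<open>u \<noteq> v\<close> by (auto simp: q gpath_Cons_iff split: if_splits)
  moreover from this have "hd q \<in> ?W" by (auto simp: gpath_def dest: hd_in_set)
  then have "hd q = w" using \<open>E u (hd q)\<close> by (auto simp: neighbours_def)
  ultimately have "gpath V E q w v" by (auto simp: gpath_def)
  then have "k \<le> plen q" using assms(2) by (simp add: le_gdist_iff)
  then show "Suc k \<le> plen p" using \<open>q \<noteq> []\<close> by (simp add: q)
qed

section \<open>Fault diameter and wide diameter\<close>

lemma disjoint_family_avoiding:
  assumes disjoint: "disjoint_family_on S I" and F: "finite F" "card F < card I"
  obtains i where "i \<in> I" "S i \<inter> F = {}"
proof (rule ccontr)
  assume "\<not> thesis"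
  then have "\<forall>i\<in>I. \<exists>x. x \<in> S i \<inter> F" using that by blast
  then obtain f where f: "\<And>i. i \<in> I \<Longrightarrow> f i \<in> S i \<inter> F" by metis
  have "inj_on f I"
  proof (rule inj_onI, rule ccontr)
    fix i j assume ij: "i \<in> I" "j \<in> I" "f i = f j" "i \<noteq> j"
    then have "S i \<inter> S j = {}" using disjoint by (intro disjoint_family_onD)
    then show False using f[of i] f[of j] ij by auto
  qed
  then have "card I \<le> card F" using f F(1) by (intro card_inj_on_le[of f]) auto
  then show False using F(2) by simp
qed

lemma fault_free_path:
  assumes P: "disj_paths V E n u v P" and F: "finite F" "F \<inter> {u, v} = {}" "card F < n"
  obtains p where "p \<in> P" "set p \<inter> F = {}"
proof -
  have "disjoint_family_on (\<lambda>p. set p - {u, v}) P"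
    using P unfolding disjoint_family_on_def disj_paths_def by blast
  moreover have "card F < card P" using P F(3) by (simp add: disj_paths_def)
  ultimately obtain p where "p \<in> P" "(set p - {u, v}) \<inter> F = {}"
    using F(1) by (blast intro: disjoint_family_avoiding)
  then show ?thesis using F(2) that by blast
qed

lemma gdist_faults_le_fault_diam:
  assumes "u \<in> V" "v \<in> V" "u \<noteq> v" "F \<subseteq> V - {u, v}" "finite F"
  shows "gdist (V - F) E u v \<le> fault_diam V E (card F)"
  unfolding fault_diam_def using assms by (intro Sup_upper) blast

lemma fault_diam_ge_isolating:
  assumes uv: "u \<in> V" "v \<in> V" "u \<noteq> v" "\<not> E u u" "\<not> E u v"
    and w: "finite (neighbours V E u)" "w \<in> neighbours V E u" "enat k \<le> gdist V E w v"
  shows "enat (Suc k) \<le> fault_diam V E (card (neighbours V E u) - 1)"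
proof -
  let ?F = "neighbours V E u - {w}"
  have "enat (Suc k) \<le> gdist (V - ?F) E u v" using uv(3) w(3) by (rule gdist_isolated_except)
  also have "\<dots> \<le> fault_diam V E (card ?F)"
    using uv w(1) by (intro gdist_faults_le_fault_diam) (auto simp: neighbours_def)
  also have "card ?F = card (neighbours V E u) - 1" using w(2) by (rule card_Diff_singleton)
  finally show ?thesis .
qed

theorem fault_diam_le_wide_diam:
  assumes "n < m"
  shows "fault_diam V E n \<le> wide_diam V E m"
  unfolding fault_diam_def
proof (rule Sup_least, clarify)
  fix u v F
  assume uv: "u \<in> V" "v \<in> V" "u \<noteq> v" and F: "F \<subseteq> V - {u, v}" "finite F" "n = card F"
  let ?width = "\<lambda>P. Sup ((\<lambda>p. enat (plen p)) ` P)"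
  have "gdist (V - F) E u v \<le> ?width P" if P: "disj_paths V E m u v P" for P
  proof -
    obtain p where p: "p \<in> P" "set p \<inter> F = {}"
      using fault_free_path[OF P F(2)] F assms by blast
    then have "gpath (V - F) E p u v" using P by (auto simp: disj_paths_def gpath_def)
    then have "gdist (V - F) E u v \<le> enat (plen p)" by (auto simp: gdist_le_iff)
    also have "\<dots> \<le> ?width P" using p by (auto intro: Sup_upper)
    finally show ?thesis .
  qed
  then have "gdist (V - F) E u v \<le> Inf {?width P | P. disj_paths V E m u v P}"
    by (auto intro!: Inf_greatest)
  also have "\<dots> \<le> wide_diam V E m"
    unfolding wide_diam_def using uv by (intro Sup_upper) auto
  finally show "gdist (V - F) E u v \<le> wide_diam V E m" .
qed

section \<open>Internally disjoint paths\<close>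

definition linkable :: "'a set \<Rightarrow> ('a \<Rightarrow> 'a \<Rightarrow> bool) \<Rightarrow> nat \<Rightarrow> nat \<Rightarrow> 'a \<Rightarrow> 'a \<Rightarrow> bool" where
  "linkable V E n k u v \<longleftrightarrow> (\<exists>P. disj_paths V E n u v P \<and> (\<forall>p\<in>P. plen p \<le> k))"

lemma wide_diam_le:
  assumes "\<And>u v. u \<in> V \<Longrightarrow> v \<in> V \<Longrightarrow> u \<noteq> v \<Longrightarrow> linkable V E n k u v"
  shows "wide_diam V E n \<le> enat k"
  unfolding wide_diam_def
proof (rule Sup_least, clarify)
  fix u v assume "u \<in> V" "v \<in> V" "u \<noteq> v"
  then obtain P where P: "disj_paths V E n u v P" "\<forall>p\<in>P. plen p \<le> k"
    using assms unfolding linkable_def by blast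
  let ?width = "\<lambda>P. Sup ((\<lambda>p. enat (plen p)) ` P)"
  have "Inf {?width P | P. disj_paths V E n u v P} \<le> ?width P" using P(1) by (auto intro: Inf_lower)
  also have "\<dots> \<le> enat k" using P(2) by (auto intro!: Sup_least)
  finally show "Inf {?width P | P. disj_paths V E n u v P} \<le> enat k" .
qed

lemma linkable_mono:
  assumes "linkable V E n k u v" "V \<subseteq> W" "n' \<le> n"
  shows "linkable W E n' k u v"
proof -
  obtain P where P: "disj_paths V E n u v P" "\<forall>p\<in>P. plen p \<le> k"
    using assms(1) by (auto simp: linkable_def)
  then obtain Q where Q: "Q \<subseteq> P" "card Q = n'" "finite Q"
    using assms(3) obtain_subset_with_card_n[of n' P] by (auto simp: disj_paths_def)
  have "gpath W E p u v" if "p \<in> Q" for p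
    using that P(1) Q(1) assms(2) by (auto simp: disj_paths_def gpath_def)
  moreover have "set p \<inter> set q \<subseteq> {u, v}" if "p \<in> Q" "q \<in> Q" "p \<noteq> q" for p q
    using that P(1) Q(1) unfolding disj_paths_def by blast
  ultimately have "disj_paths W E n' u v Q" using Q(2,3) by (simp add: disj_paths_def)
  then show ?thesis using P(2) Q(1) by (auto simp: linkable_def)
qed

lemma linkable_image:
  assumes linkable: "linkable V E n k u v" and inj: "inj_on g {p. gpath V E p u v}"
    and path: "\<And>p. gpath V E p u v \<Longrightarrow> gpath W E' (g p) u' v' \<and> plen (g p) \<le> plen p"
    and disj: "\<And>p q. gpath V E p u v \<Longrightarrow> gpath V E q u v \<Longrightarrow> set p \<inter> set q \<subseteq> {u, v} \<Longrightarrow>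
      set (g p) \<inter> set (g q) \<subseteq> {u', v'}"
  shows "linkable W E' n k u' v'"
proof -
  obtain P where "disj_paths V E n u v P" "\<forall>p\<in>P. plen p \<le> k"
    using linkable by (auto simp: linkable_def)
  then have P: "finite P" "card P = n" "\<And>p. p \<in> P \<Longrightarrow> gpath V E p u v \<and> plen p \<le> k"
    "\<And>p q. p \<in> P \<Longrightarrow> q \<in> P \<Longrightarrow> p \<noteq> q \<Longrightarrow> set p \<inter> set q \<subseteq> {u, v}"
    by (auto simp: disj_paths_def)
  have "inj_on g P" using inj P(3) by (auto intro: inj_on_subset)
  moreover have "set (g p) \<inter> set (g q) \<subseteq> {u', v'}" if "p \<in> P" "q \<in> P" "g p \<noteq> g q" for p q
    by (rule disj) (use that P(3,4) in \<open>auto dest: subsetD\<close>)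
  ultimately have "disj_paths W E' n u' v' (g ` P)"
    using P(1-3) path by (auto simp: disj_paths_def card_image)
  moreover have "\<forall>p\<in>g ` P. plen p \<le> k" using P(3) path by (auto intro: order_trans)
  ultimately show ?thesis unfolding linkable_def by blast
qed

lemma linkable_map:
  assumes "linkable V E n k u v" and inj: "inj_on f V" and "f ` V \<subseteq> W"
    and "\<And>x y. x \<in> V \<Longrightarrow> y \<in> V \<Longrightarrow> E x y \<Longrightarrow> E' (f x) (f y)"
  shows "linkable W E' n k (f u) (f v)"
proof (rule linkable_image[OF assms(1), of "map f"])
  show "inj_on (map f) {p. gpath V E p u v}"
    by (rule inj_on_mapI, rule inj_on_subset[OF inj]) (auto simp: gpath_def)
  show "gpath W E' (map f p) (f u) (f v) \<and> plen (map f p) \<le> plen p" if "gpath V E p u v" for p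
    using gpath_map[of V E p u v f W E', OF that assms(2-4)] by simp
  show "set (map f p) \<inter> set (map f q) \<subseteq> {f u, f v}"
    if "gpath V E p u v" "gpath V E q u v" "set p \<inter> set q \<subseteq> {u, v}" for p q
  proof -
    have "set p \<subseteq> V" "set q \<subseteq> V" using that by (auto simp: gpath_def)
    then have "set (map f p) \<inter> set (map f q) = f ` (set p \<inter> set q)"
      by (simp add: inj_on_image_Int[OF inj])
    also have "\<dots> \<subseteq> {f u, f v}" using that(3) by auto
    finally show ?thesis .
  qed
qed

lemma linkable_involution:
  assumes "linkable V E n k (f u) (f v)" and "\<And>x. f (f x) = x" and "f ` V \<subseteq> W"
    and "\<And>x y. x \<in> V \<Longrightarrow> y \<in> V \<Longrightarrow> E x y \<Longrightarrow> E (f x) (f y)"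
  shows "linkable W E n k u v"
proof -
  have "inj_on f V" using assms(2) by (rule inj_on_inverseI)
  then have "linkable W E n k (f (f u)) (f (f v))"
    using assms(1,3,4) by (intro linkable_map[of V E n k "f u" "f v" f W E])
  then show ?thesis by (simp only: assms(2))
qed

lemma linkable_sym:
  assumes "linkable V E n k u v" and "symp E"
  shows "linkable V E n k v u"
  by (rule linkable_image[OF assms(1), of rev])
    (use gpath_rev[OF _ assms(2)] in \<open>auto simp: inj_on_def\<close>)

lemma linkable_endpoints:
  assumes "u \<noteq> v" "1 \<le> k"
  shows "linkable {u, v} E (of_bool (E u v)) k u v"
proof (cases "E u v")
  case True
  then have "disj_paths {u, v} E 1 u v {[u, v]}"
    using assms(1) by (auto simp: disj_paths_def gpath_Cons_iff)
  then show ?thesis using True assms(2) by (auto simp: linkable_def plen_def)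
qed (auto simp: linkable_def disj_paths_def)

text \<open>The last condition excludes the edge from \<open>u\<close> to \<open>v\<close>, so that disjoint sets give distinct
  paths.\<close>
definition route :: "('a \<Rightarrow> 'a \<Rightarrow> bool) \<Rightarrow> nat \<Rightarrow> 'a \<Rightarrow> 'a \<Rightarrow> 'a set \<Rightarrow> bool" where
  "route E k u v S \<longleftrightarrow> (\<exists>p. gpath ({u, v} \<union> S) E p u v \<and> plen p \<le> k \<and> set p \<inter> S \<noteq> {})"

lemma routeI:
  assumes "a \<in> S" "E u a" "gdist (insert v S) E a v \<le> enat l" "l < k" "u \<noteq> v" "u \<notin> S"
  shows "route E k u v S"
proof -
  obtain p where p: "gpath (insert v S) E p a v" "plen p \<le> l"
    using assms(3) by (auto simp: gdist_le_iff)
  then have "p \<noteq> []" "hd p = a" "u \<notin> set p" "a \<in> set p" using assms(5,6) by (auto simp: gpath_def)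
  moreover have "gpath ({u, v} \<union> S) E p a v" using p(1) by (auto simp: gpath_def)
  ultimately have "gpath ({u, v} \<union> S) E (u # p) u v" "set (u # p) \<inter> S \<noteq> {}" "plen (u # p) \<le> k"
    using assms(1,2,4) p(2) by (auto simp: gpath_Cons_iff)
  then show ?thesis unfolding route_def by blast
qed

lemma linkable_insert_route:
  assumes linkable: "linkable U E n k u v" and route: "route E k u v S"
    and "U \<inter> S = {}" and "{u, v} \<subseteq> U"
  shows "linkable (U \<union> S) E (Suc n) k u v"
proof -
  obtain P where P: "disj_paths U E n u v P" "\<forall>p\<in>P. plen p \<le> k"
    using linkable by (auto simp: linkable_def)
  obtain p where p: "gpath ({u, v} \<union> S) E p u v" "plen p \<le> k" "set p \<inter> S \<noteq> {}"
    using route by (auto simp: route_def)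
  have U: "set q \<subseteq> U" if "q \<in> P" for q using P(1) that by (auto simp: disj_paths_def gpath_def)
  then have "p \<notin> P" using p(3) \<open>U \<inter> S = {}\<close> by blast
  moreover have "set p \<inter> set q \<subseteq> {u, v}" if "q \<in> P" for q
    using U[OF that] p(1) \<open>U \<inter> S = {}\<close> by (auto simp: gpath_def)
  moreover have "gpath (U \<union> S) E q u v" if "q \<in> insert p P" for q
    using that p(1) P(1) \<open>{u, v} \<subseteq> U\<close> by (auto simp: disj_paths_def gpath_def)
  ultimately have "disj_paths (U \<union> S) E (Suc n) u v (insert p P)"
    using P(1) by (auto simp: disj_paths_def)
  then show ?thesis using P(2) p(2) by (auto simp: linkable_def)
qed

lemma linkable_add_routes:
  assumes "finite I" and linkable: "linkable U E n k u v" and "{u, v} \<subseteq> U"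
    and "\<And>i. i \<in> I \<Longrightarrow> route E k u v (S i)" and "\<And>i. i \<in> I \<Longrightarrow> U \<inter> S i = {}"
    and "disjoint_family_on S I"
  shows "linkable (U \<union> (\<Union>i\<in>I. S i)) E (n + card I) k u v"
  using assms(1,4-6)
proof (induction I)
  case (insert i I)
  let ?U = "U \<union> (\<Union>i\<in>I. S i)"
  have "linkable ?U E (n + card I) k u v"
    using insert by (simp add: disjoint_family_on_insert)
  moreover have "?U \<inter> S i = {}"
    using insert by (auto simp: disjoint_family_on_insert)
  ultimately have "linkable (?U \<union> S i) E (Suc (n + card I)) k u v"
    using insert.prems(1) assms(3) by (intro linkable_insert_route) auto
  then show ?case using insert.hyps by (simp add: ac_simps)
qed (use linkable in simp)

section \<open>Matchings\<close>

definition matching :: "'a set \<Rightarrow> 'b set \<Rightarrow> nat \<Rightarrow> ('a \<times> 'b) set \<Rightarrow> bool" where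
  "matching A B k M \<longleftrightarrow>
     M \<subseteq> A \<times> B \<and> finite M \<and> card M = k \<and> inj_on fst M \<and> inj_on snd M"

lemma matching_mono: "matching A B k M \<Longrightarrow> A \<subseteq> A' \<Longrightarrow> B \<subseteq> B' \<Longrightarrow> matching A' B' k M"
  unfolding matching_def by blast

lemma matching_disjoint_coordinates:
  assumes "matching A B k M" "(a, b) \<in> M" "(a', b') \<in> M" "(a, b) \<noteq> (a', b')"
  shows "a \<noteq> a'" "b \<noteq> b'"
  using assms unfolding matching_def inj_on_def by force+

text \<open>The matchings are the \<open>k\<close> rotations of a bijection.\<close>
lemma disjoint_matchings:
  assumes "k \<le> card A" "k \<le> card B" "0 < k"
  obtains M where "\<And>c. matching A B k (M c)" "disjoint_family_on M {..<k}"
proof -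
  obtain A' where A': "A' \<subseteq> A" "card A' = k" "finite A'"
    using obtain_subset_with_card_n[OF assms(1)] by auto
  obtain B' where B': "B' \<subseteq> B" "card B' = k" "finite B'"
    using obtain_subset_with_card_n[OF assms(2)] by auto
  obtain a where a: "bij_betw a {..<k} A'"
    using A'(2,3) ex_bij_betw_nat_finite by (metis lessThan_atLeast0)
  obtain b where b: "bij_betw b {..<k} B'"
    using B'(2,3) ex_bij_betw_nat_finite by (metis lessThan_atLeast0)
  define M where "M c = (\<lambda>i. (a i, b ((i + c) mod k))) ` {..<k}" for c
  have a_eq: "a i = a j \<longleftrightarrow> i = j" if "i < k" "j < k" for i j
    using a that by (auto simp: bij_betw_def inj_on_eq_iff)
  have b_eq: "b (i mod k) = b (j mod k) \<longleftrightarrow> [i = j] (mod k)" for i j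
    using b assms(3) by (auto simp: bij_betw_def inj_on_eq_iff cong_def)
  have "matching A B k (M c)" for c
    unfolding matching_def
  proof (intro conjI)
    show "M c \<subseteq> A \<times> B" using a b A'(1) B'(1) assms(3) by (auto simp: M_def bij_betw_def)
    show "finite (M c)" by (simp add: M_def)
    show "card (M c) = k" by (simp add: M_def card_image inj_on_def a_eq)
    show "inj_on fst (M c)" by (auto simp: M_def inj_on_def a_eq)
    show "inj_on snd (M c)"
      by (auto simp: M_def inj_on_def b_eq cong_add_rcancel_nat dest: cong_less_modulus_unique_nat)
  qed
  moreover have "c = d" if p: "p \<in> M c" "p \<in> M d" and "c < k" "d < k" for c d p
  proof -
    obtain i where "[i + c = i + d] (mod k)" using p by (auto simp: M_def a_eq b_eq)
    then have "[c = d] (mod k)" by (simp add: cong_add_lcancel_nat)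
    then show ?thesis using \<open>c < k\<close> \<open>d < k\<close> by (rule cong_less_modulus_unique_nat)
  qed
  then have "disjoint_family_on M {..<k}" by (auto simp: disjoint_family_on_def)
  ultimately show ?thesis by (rule that)
qed

lemma matching_avoiding:
  assumes "k \<le> card A" "k \<le> card B" "finite F" "card F < k"
  obtains M where "matching A B k M" "M \<inter> F = {}"
proof -
  obtain M where M: "\<And>c. matching A B k (M c)" "disjoint_family_on M {..<k}"
    using disjoint_matchings[OF assms(1,2)] assms(4) by auto
  obtain c where "M c \<inter> F = {}"
    using disjoint_family_avoiding[OF M(2) assms(3)] assms(4) by auto
  then show ?thesis using that M(1) by blast
qed

section \<open>Hamming distance and intervals of words\<close>

definition hamming :: "'a list \<Rightarrow> 'a list \<Rightarrow> nat" where
  "hamming X Y = length (filter (\<lambda>(x, y). x \<noteq> y) (zip X Y))"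

lemma hamming_Nil [simp]: "hamming [] Y = 0"
  by (simp add: hamming_def)

lemma hamming_Cons [simp]:
  "hamming (x # X) (y # Y) = (if x = y then hamming X Y else Suc (hamming X Y))"
  by (simp add: hamming_def)

lemma hamming_le_length: "hamming X Y \<le> length X"
  unfolding hamming_def using length_filter_le[of _ "zip X Y"] by (rule order_trans) simp

lemma hamming_self [simp]: "hamming X X = 0"
  by (induction X) simp_all

lemma hamming_eq_0_iff: "length X = length Y \<Longrightarrow> hamming X Y = 0 \<longleftrightarrow> X = Y"
  by (induction X Y rule: list_induct2) auto

lemma hamming_commute: "length X = length Y \<Longrightarrow> hamming X Y = hamming Y X"
  by (induction X Y rule: list_induct2) auto

lemma hamming_triangle:
  "length X = length Y \<Longrightarrow> length Y = length Z \<Longrightarrow> hamming X Z \<le> hamming X Y + hamming Y Z"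
  by (induction X Y Z rule: list_induct3) auto

lemma hamming_replicate: "x \<noteq> y \<Longrightarrow> hamming (replicate n x) (replicate n y) = n"
  by (induction n) simp_all

lemma differ_one_iff_hamming: "differ_one X Y \<longleftrightarrow> length X = length Y \<and> hamming X Y = 1"
proof -
  have "hamming X Y = card {i. i < length X \<and> X ! i \<noteq> Y ! i}" if "length X = length Y"
    using that by (simp add: hamming_def length_filter_conv_card cong: conj_cong)
  then show ?thesis by (auto simp: differ_one_def)
qed

lemma differ_one_Cons [simp]:
  "differ_one (x # X) (y # Y) \<longleftrightarrow> (if x = y then differ_one X Y else X = Y)"
  by (auto simp: differ_one_iff_hamming hamming_eq_0_iff)

lemma differ_one_Nil [simp]: "\<not> differ_one [] Y"
  by (simp add: differ_one_iff_hamming)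

lemma differ_one_length: "differ_one X Y \<Longrightarrow> length X = length Y"
  by (simp add: differ_one_iff_hamming)

lemma differ_one_ConsE:
  assumes "differ_one (x # X) P"
  obtains (tail) Q where "P = x # Q" "differ_one X Q" | (head) z where "P = z # X" "z \<noteq> x"
  using assms by (cases P) (auto dest: differ_one_length split: if_splits)

lemma differ_one_irrefl [simp]: "\<not> differ_one X X"
  by (simp add: differ_one_iff_hamming)

lemma differ_one_sym: "differ_one X Y \<Longrightarrow> differ_one Y X"
  by (metis differ_one_iff_hamming hamming_commute)

lemma hamming_differ_one:
  assumes "differ_one X Y" "length Z = length Y"
  shows "hamming X Z \<le> hamming Y Z + 1"
proof -
  have "hamming X Z \<le> hamming X Y + hamming Y Z"
    using assms by (intro hamming_triangle) (auto dest: differ_one_length)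
  then show ?thesis using assms(1) by (simp add: differ_one_iff_hamming)
qed

definition interval :: "'a list \<Rightarrow> 'a list \<Rightarrow> 'a list set" where
  "interval X Y = listset (map2 (\<lambda>x y. {x, y}) X Y)"

lemma interval_Nil [simp]: "interval [] [] = {[]}"
  by (simp add: interval_def)

lemma interval_Cons [simp]:
  "interval (x # X) (y # Y) = (#) x ` interval X Y \<union> (#) y ` interval X Y"
  by (auto simp: interval_def set_Cons_def)

lemma interval_self [simp]: "interval X X = {X}"
  by (induction X) auto

lemma left_in_interval [simp]: "length X = length Y \<Longrightarrow> X \<in> interval X Y"
  by (induction X Y rule: list_induct2) auto

lemma right_in_interval [simp]: "length X = length Y \<Longrightarrow> Y \<in> interval X Y"
  by (induction X Y rule: list_induct2) auto

lemma gdist_differ_one_Cons: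
  assumes "gdist S differ_one X Y \<le> enat k" "(#) x ` S \<subseteq> T"
  shows "gdist T differ_one (x # X) (x # Y) \<le> enat k"
  using assms(1) by (rule gdist_map) (use assms(2) in auto)

lemma gdist_interval:
  "length X = length Y \<Longrightarrow> gdist (interval X Y) differ_one X Y \<le> enat (hamming X Y)"
proof (induction X Y rule: list_induct2)
  case (Cons x X y Y)
  let ?I = "interval (x # X) (y # Y)"
  have "gdist ?I differ_one (x # X) (x # Y) \<le> enat (hamming X Y)"
    using Cons.IH by (rule gdist_differ_one_Cons) simp
  also have "gdist ?I differ_one (x # Y) (y # Y) \<le> enat (if x = y then 0 else 1)"
    using Cons.hyps by (auto intro: gdist_edge gdist_refl)
  finally show ?case by (simp split: if_splits)
qed (simp add: gdist_refl)

section \<open>Fans of geodesics\<close>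

fun toward :: "'a list \<Rightarrow> 'a list \<Rightarrow> 'a list" where
  "toward (x # X) (y # Y) = (if x = y then x # toward X Y else y # X)"
| "toward X _ = X"

lemma toward_self [simp]: "toward X X = X"
  by (induction X) simp_all

lemma length_toward [simp]: "length (toward X Y) = length X"
  by (induction X Y rule: toward.induct) auto

lemma differ_one_toward: "length X = length Y \<Longrightarrow> X \<noteq> Y \<Longrightarrow> differ_one X (toward X Y)"
  by (induction X Y rule: list_induct2) auto

lemma hamming_toward: "length X = length Y \<Longrightarrow> X \<noteq> Y \<Longrightarrow> hamming X Y = Suc (hamming (toward X Y) Y)"
  by (induction X Y rule: list_induct2) auto

lemma toward_eq_if_differ_one: "differ_one X Y \<Longrightarrow> toward X Y = Y"
  using differ_one_toward[of X Y] hamming_toward[of X Y]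
  by (metis differ_one_iff_hamming differ_one_irrefl hamming_eq_0_iff length_toward One_nat_def
      nat.inject)

lemma toward_in_interval: "length X = length Y \<Longrightarrow> toward X Y \<in> interval X Y"
  by (induction X Y rule: list_induct2) auto

lemma interval_toward_subset: "length X = length Y \<Longrightarrow> interval (toward X Y) Y \<subseteq> interval X Y"
  by (induction X Y rule: list_induct2) auto

lemma interval_inter_ball_toward:
  "length X = length Y \<Longrightarrow> W \<in> interval Y (toward X Y) \<Longrightarrow> differ_one X W \<or> W = X \<Longrightarrow> W = toward X Y"
  by (induction X Y arbitrary: W rule: list_induct2) (auto split: if_splits)

text \<open>The fan from the neighbours \<open>P\<close> of \<open>X\<close> to \<open>Y\<close> in the Hamming graph. If \<open>x \<noteq> y\<close>, the words
  \<open>x # P\<close> enter \<open>y # fan X Y P\<close> at once, except for \<open>P = toward X Y\<close>, which yields its place to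
  \<open>y # X\<close> and keeps \<open>x\<close> until its last step.\<close>
fun fan :: "'a list \<Rightarrow> 'a list \<Rightarrow> 'a list \<Rightarrow> 'a list set" where
  "fan (x # X) (y # Y) (z # P) =
     (if z = x then
        if x = y then (#) x ` fan X Y P
        else if P = toward X Y then (#) x ` insert Y (fan X Y P)
        else insert (x # P) ((#) y ` fan X Y P)
      else if z \<noteq> y then (#) z ` interval X Y
      else if X = Y then {}
      else insert (y # X) ((#) y ` fan X Y (toward X Y)))"
| "fan _ _ _ = {}"

lemma fan_subset_interval: "length X = length Y \<Longrightarrow> differ_one X P \<Longrightarrow> fan X Y P \<subseteq> interval P Y"
proof (induction X Y arbitrary: P rule: list_induct2)
  case (Cons x X y Y)
  from Cons.prems show ?case
  proof (cases rule: differ_one_ConsE)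
    case (tail Q)
    have "{Q, Y} \<subseteq> interval Q Y" using Cons.hyps differ_one_length[OF tail(2)] by simp
    then show ?thesis using tail Cons.IH[of Q] by auto
  next
    case (head z)
    have "fan X Y (toward X Y) \<subseteq> interval X Y" if "X \<noteq> Y"
      using Cons.IH differ_one_toward interval_toward_subset Cons.hyps that by blast
    then show ?thesis using head Cons.hyps by auto
  qed
qed simp

lemma source_notin_fan: "length X = length Y \<Longrightarrow> differ_one X P \<Longrightarrow> X \<notin> fan X Y P"
  by (induction X Y arbitrary: P rule: list_induct2)
    (auto elim!: differ_one_ConsE split: if_splits)

lemma target_notin_fan: "length X = length Y \<Longrightarrow> differ_one X P \<Longrightarrow> Y \<notin> fan X Y P"
  by (induction X Y arbitrary: P rule: list_induct2)
    (auto elim!: differ_one_ConsE simp: differ_one_toward split: if_splits)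

lemma neighbour_in_fan: "length X = length Y \<Longrightarrow> differ_one X P \<Longrightarrow> P \<noteq> Y \<Longrightarrow> P \<in> fan X Y P"
  by (induction X Y arbitrary: P rule: list_induct2)
    (auto elim!: differ_one_ConsE simp: image_iff split: if_splits, blast)

lemma fan_disjoint:
  "length X = length Y \<Longrightarrow> differ_one X P \<Longrightarrow> differ_one X Q \<Longrightarrow> P \<noteq> Q \<Longrightarrow> fan X Y P \<inter> fan X Y Q = {}"
proof (induction X Y arbitrary: P Q rule: list_induct2)
  case (Cons x X y Y)
  let ?fan = "fan (x # X) (y # Y)"
  have tails: "?fan (x # P') \<inter> ?fan (x # Q') = {}"
    if PQ: "differ_one X P'" "differ_one X Q'" "P' \<noteq> Q'" for P' Q'
  proof -
    have "P' \<noteq> Y" if "Q' = toward X Y" using PQ that toward_eq_if_differ_one by metis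
    moreover have "Q' \<noteq> Y" if "P' = toward X Y" using PQ that toward_eq_if_differ_one by metis
    moreover have "P' = Y \<or> P' \<in> fan X Y P'" "Q' = Y \<or> Q' \<in> fan X Y Q'"
      using neighbour_in_fan[OF Cons.hyps] PQ by blast+
    moreover have "fan X Y P' \<inter> fan X Y Q' = {}" using Cons.IH PQ by blast
    ultimately show ?thesis using PQ(3) by (auto split: if_splits)
  qed
  have mixed: "?fan (x # P') \<inter> ?fan (z # X) = {}" if P': "differ_one X P'" "z \<noteq> x" for P' z
  proof -
    have "fan X Y P' \<inter> fan X Y (toward X Y) = {}" if "X \<noteq> Y" "P' \<noteq> toward X Y"
      using Cons.IH P'(1) differ_one_toward[OF Cons.hyps] that by blast
    moreover have "X \<notin> fan X Y P'" using source_notin_fan[OF Cons.hyps] P'(1) by blast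
    ultimately show ?thesis using P'(2) by (auto split: if_splits)
  qed
  have heads: "?fan (z # X) \<inter> ?fan (z' # X) = {}" if "z \<noteq> x" "z' \<noteq> x" "z \<noteq> z'" for z z'
    using that by auto
  from mixed have mixed': "?fan (z # X) \<inter> ?fan (x # P') = {}" if "differ_one X P'" "z \<noteq> x" for P' z
    using that by (subst Int_commute)
  show ?case using Cons.prems
    by (elim differ_one_ConsE) (simp_all add: tails mixed mixed' heads del: fan.simps)
qed simp

lemma gdist_fan_tail:
  assumes len: "length X = length Y" and Q: "differ_one X Q"
    and tail: "gdist (insert Y (fan X Y Q)) differ_one Q Y \<le> enat (hamming Q Y)"
  shows "gdist (insert (y # Y) (fan (x # X) (y # Y) (x # Q))) differ_one (x # Q) (y # Y)
    \<le> enat (hamming (x # Q) (y # Y))"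
proof -
  let ?S = "insert (y # Y) (fan (x # X) (y # Y) (x # Q))"
  consider (same) "x = y" | (toward) "x \<noteq> y" "Q = toward X Y" | (other) "x \<noteq> y" "Q \<noteq> toward X Y"
    by blast
  then show ?thesis
  proof cases
    case same
    then show ?thesis using gdist_differ_one_Cons[OF tail, of x ?S] by simp
  next
    case toward
    have "gdist ?S differ_one (x # Q) (x # Y) \<le> enat (hamming Q Y)"
      using tail by (rule gdist_differ_one_Cons) (use toward in auto)
    also have "gdist ?S differ_one (x # Y) (y # Y) \<le> enat 1"
      using toward by (intro gdist_edge) auto
    finally show ?thesis using toward by simp
  next
    case other
    have "gdist ?S differ_one (x # Q) (y # Q) \<le> enat 1"
      using other neighbour_in_fan[OF len Q] by (intro gdist_edge) auto
    also have "gdist ?S differ_one (y # Q) (y # Y) \<le> enat (hamming Q Y)"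
      using tail by (rule gdist_differ_one_Cons) (use other in auto)
    finally show ?thesis using other by simp
  qed
qed

lemma gdist_fan_head:
  assumes len: "length X = length Y" and "z \<noteq> x"
    and tail: "X \<noteq> Y \<Longrightarrow> gdist (insert Y (fan X Y (toward X Y))) differ_one (toward X Y) Y
      \<le> enat (hamming (toward X Y) Y)"
  shows "gdist (insert (y # Y) (fan (x # X) (y # Y) (z # X))) differ_one (z # X) (y # Y)
    \<le> enat (hamming (z # X) (y # Y))"
proof -
  let ?S = "insert (y # Y) (fan (x # X) (y # Y) (z # X))"
  consider (third_letter) "z \<noteq> y" | (target) "z = y" "X = Y" | (detour) "z = y" "X \<noteq> Y" by blast
  then show ?thesis
  proof cases
    case third_letter
    have "gdist ?S differ_one (z # X) (z # Y) \<le> enat (hamming X Y)"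
      using gdist_interval[OF len]
      by (rule gdist_differ_one_Cons) (use third_letter \<open>z \<noteq> x\<close> in auto)
    also have "gdist ?S differ_one (z # Y) (y # Y) \<le> enat 1"
      using third_letter \<open>z \<noteq> x\<close> len by (intro gdist_edge) auto
    finally show ?thesis using third_letter by simp
  next
    case target
    then show ?thesis by (simp add: gdist_refl)
  next
    case detour
    let ?Q = "toward X Y"
    have Q: "differ_one X ?Q" "hamming X Y = Suc (hamming ?Q Y)"
      using differ_one_toward hamming_toward len detour by auto
    have "gdist ?S differ_one (z # X) (y # ?Q) \<le> enat 1"
      using detour \<open>z \<noteq> x\<close> Q neighbour_in_fan[OF len, of ?Q] by (intro gdist_edge) auto
    also have "gdist ?S differ_one (y # ?Q) (y # Y) \<le> enat (hamming ?Q Y)"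
      using tail[OF detour(2)] by (rule gdist_differ_one_Cons) (use detour \<open>z \<noteq> x\<close> in auto)
    finally show ?thesis using detour Q by simp
  qed
qed

lemma gdist_fan:
  "length X = length Y \<Longrightarrow> differ_one X P \<Longrightarrow>
     gdist (insert Y (fan X Y P)) differ_one P Y \<le> enat (hamming P Y)"
proof (induction X Y arbitrary: P rule: list_induct2)
  case (Cons x X y Y)
  from Cons.prems show ?case
  proof (cases rule: differ_one_ConsE)
    case (tail Q)
    then show ?thesis using gdist_fan_tail[OF Cons.hyps _ Cons.IH] by blast
  next
    case (head z)
    then show ?thesis
      using gdist_fan_head[OF Cons.hyps _ Cons.IH] differ_one_toward[OF Cons.hyps] by blast
  qed
qed simp

section \<open>Ternary words\<close>

lemma tern_words_length: "X \<in> tern_words k \<Longrightarrow> length X = k"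
  by (simp add: tern_words_def)

lemma interval_subset_tern_words:
  assumes "X \<in> tern_words k" "Y \<in> tern_words k"
  shows "interval X Y \<subseteq> tern_words k"
proof
  fix W assume "W \<in> interval X Y"
  have "length X = length Y" using assms by (simp add: tern_words_def)
  then have "length W = length X \<and> set W \<subseteq> set X \<union> set Y"
    using \<open>W \<in> interval X Y\<close>
  proof (induction X Y arbitrary: W rule: list_induct2)
    case (Cons x X y Y)
    from Cons.prems obtain w W' where "W = w # W'" "w = x \<or> w = y" "W' \<in> interval X Y" by auto
    then show ?case using Cons.IH[of W'] by auto
  qed simp
  then show "W \<in> tern_words k" using assms by (simp add: tern_words_def) blast
qed

lemma hamming_le_tern_words: "X \<in> tern_words k \<Longrightarrow> hamming X Y \<le> k"
  using hamming_le_length tern_words_length by metis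

definition detour_word :: "nat \<Rightarrow> nat list \<Rightarrow> nat list \<Rightarrow> nat list \<Rightarrow> bool" where
  "detour_word k Z Z' W \<longleftrightarrow>
     W \<in> tern_words k \<and> W \<noteq> Z \<and> W \<noteq> Z' \<and> hamming Z W + hamming W Z' \<le> Suc k"

lemma detour_word_exists:
  assumes "Z \<in> tern_words k" "Z' \<in> tern_words k" "1 \<le> k"
  obtains W where "detour_word k Z Z' W"
proof -
  obtain z zs z' zs' where Z: "Z = z # zs" "Z' = z' # zs'" "length zs < k"
    using assms by (cases Z; cases Z') (auto simp: tern_words_def)
  have "\<exists>w\<in>{0, 1, 2}. w \<noteq> z \<and> w \<noteq> z'" by (cases "z = 0"; cases "z' = 0") force+
  then obtain w where w: "w \<in> {0, 1, 2}" "w \<noteq> z" "w \<noteq> z'" by blast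
  then have "hamming Z (w # zs') + hamming (w # zs') Z' \<le> Suc k"
    using Z hamming_le_length[of zs zs'] by simp
  then have "detour_word k Z Z' (w # zs')"
    using assms(2) w Z by (auto simp: detour_word_def tern_words_def)
  then show ?thesis by (rule that)
qed

lemma finite_differ_one: "finite A \<Longrightarrow> finite {P. differ_one X P \<and> set P \<subseteq> A}"
  by (rule finite_subset[OF _ finite_lists_length_eq[of A "length X"]])
    (auto dest: differ_one_length)

lemma card_differ_one:
  assumes "finite A" "set X \<subseteq> A"
  shows "card {P. differ_one X P \<and> set P \<subseteq> A} = length X * (card A - 1)"
  using assms(2)
proof (induction X)
  case (Cons x X)
  let ?N = "{P. differ_one X P \<and> set P \<subseteq> A}" and ?H = "(\<lambda>z. z # X) ` (A - {x})"
  have "{P. differ_one (x # X) P \<and> set P \<subseteq> A} = (#) x ` ?N \<union> ?H"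
    using Cons.prems by (auto elim!: differ_one_ConsE)
  moreover have "card ((#) x ` ?N \<union> ?H) = card ?N + card ?H"
    using finite_differ_one \<open>finite A\<close> by (subst card_Un_disjoint) (auto simp: card_image)
  moreover have "card ?H = card A - 1"
    using Cons.prems \<open>finite A\<close> by (simp add: card_image inj_on_def)
  ultimately show ?case using Cons by simp
qed simp

abbreviation nbrs :: "nat \<Rightarrow> nat list \<Rightarrow> nat list set" where
  "nbrs k \<equiv> neighbours (tern_words k) differ_one"

abbreviation closed_nbrs :: "nat \<Rightarrow> nat list \<Rightarrow> nat list set" where
  "closed_nbrs k X \<equiv> insert X (nbrs k X)"

lemma nbrs_iff: "P \<in> nbrs k X \<longleftrightarrow> P \<in> tern_words k \<and> differ_one X P"
  by (simp add: neighbours_def)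

lemma
  assumes "X \<in> tern_words k"
  shows finite_nbrs: "finite (nbrs k X)" and card_nbrs: "card (nbrs k X) = 2 * k"
proof -
  have "nbrs k X = {P. differ_one X P \<and> set P \<subseteq> {0, 1, 2}}"
    using assms by (auto simp: neighbours_def tern_words_def dest: differ_one_length)
  then show "finite (nbrs k X)" "card (nbrs k X) = 2 * k"
    using assms card_differ_one[of "{0, 1, 2}" X] finite_differ_one[of "{0, 1, 2}" X]
    by (simp_all add: tern_words_def)
qed

lemma card_closed_nbrs: "X \<in> tern_words k \<Longrightarrow> card (closed_nbrs k X) = 2 * k + 1"
  by (simp add: card_insert_if finite_nbrs card_nbrs nbrs_iff)

lemma toward_in_closed_nbrs:
  assumes "X \<in> tern_words k" "Y \<in> tern_words k"
  shows "toward X Y \<in> closed_nbrs k X"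
proof (cases "X = Y")
  case False
  have "length X = length Y" using assms by (simp add: tern_words_length)
  then show ?thesis
    using False toward_in_interval interval_subset_tern_words[OF assms] differ_one_toward
    by (auto simp: nbrs_iff)
qed simp

section \<open>Routes in the exchanged 3-ary cube\<close>

lemma E3C_V_iff [simp]: "(A, B, C, d) \<in> E3C_V r s t \<longleftrightarrow>
    A \<in> tern_words r \<and> B \<in> tern_words s \<and> C \<in> tern_words t \<and> d \<in> {0, 1, 2}"
  by (simp add: E3C_V_def)

lemma symp_E3C_E: "symp E3C_E"
  by (auto simp: symp_def E3C_E_def dest: differ_one_sym)

lemma E3C_E_iff: "E3C_E (A, B, C, d) (A', B', C', d') \<longleftrightarrow>
    A = A' \<and> B = B' \<and> C = C' \<and> d \<noteq> d' \<or>
    d = 0 \<and> d' = 0 \<and> A = A' \<and> B = B' \<and> differ_one C C' \<or>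
    d = 1 \<and> d' = 1 \<and> A = A' \<and> C = C' \<and> differ_one B B' \<or>
    d = 2 \<and> d' = 2 \<and> B = B' \<and> C = C' \<and> differ_one A A'"
  by (auto simp: E3C_E_def)

text \<open>A route is given by its corners, where one leg ends and the next one starts. The hull of a leg
  contains all shortest paths along the leg, so that the disjointness of routes is a matter of
  coordinates.\<close>
fun leg :: "e3c_vertex \<Rightarrow> e3c_vertex \<Rightarrow> bool" where
  "leg (A, B, C, d) (A', B', C', d') \<longleftrightarrow>
     A = A' \<and> B = B' \<and> C = C' \<or>
     d = 0 \<and> d' = 0 \<and> A = A' \<and> B = B' \<and> length C = length C' \<or>
     d = 1 \<and> d' = 1 \<and> A = A' \<and> C = C' \<and> length B = length B' \<or>
     d = 2 \<and> d' = 2 \<and> B = B' \<and> C = C' \<and> length A = length A'"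

fun leg_length :: "e3c_vertex \<Rightarrow> e3c_vertex \<Rightarrow> nat" where
  "leg_length (A, B, C, d) (A', B', C', d') =
     hamming A A' + hamming B B' + hamming C C' + of_bool (d \<noteq> d')"

fun leg_hull :: "e3c_vertex \<Rightarrow> e3c_vertex \<Rightarrow> e3c_vertex set" where
  "leg_hull (A, B, C, d) (A', B', C', d') = interval A A' \<times> interval B B' \<times> interval C C' \<times> {d, d'}"

lemma gdist_leg:
  assumes "leg x y"
  shows "gdist (leg_hull x y) E3C_E x y \<le> enat (leg_length x y)"
proof -
  obtain A B C d A' B' C' d' where xy: "x = (A, B, C, d)" "y = (A', B', C', d')"
    by (cases x; cases y)
  have lift: "gdist (leg_hull x y) E3C_E (f W) (f W') \<le> enat (hamming W W')"
    if "length W = length W'" "f ` interval W W' \<subseteq> leg_hull x y" "inj f"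
      "\<And>U U'. differ_one U U' \<Longrightarrow> E3C_E (f U) (f U')" for f W W'
    using gdist_interval[OF that(1)] by (rule gdist_map) (use that in \<open>auto intro: inj_on_subset\<close>)
  from assms consider (layer) "A = A'" "B = B'" "C = C'"
    | (C) "d = 0" "d' = 0" "A = A'" "B = B'" "length C = length C'"
    | (B) "d = 1" "d' = 1" "A = A'" "C = C'" "length B = length B'"
    | (A) "d = 2" "d' = 2" "B = B'" "C = C'" "length A = length A'"
    by (auto simp: xy)
  then show ?thesis
  proof cases
    case layer
    then show ?thesis
      by (cases "d = d'") (auto simp: xy E3C_E_iff intro: gdist_edge gdist_refl)
  next
    case C
    then show ?thesis using lift[of C C' "\<lambda>C. (A, B, C, 0)"] by (auto simp: xy E3C_E_iff inj_def)
  next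
    case B
    then show ?thesis using lift[of B B' "\<lambda>B. (A, B, C, 1)"] by (auto simp: xy E3C_E_iff inj_def)
  next
    case A
    then show ?thesis using lift[of A A' "\<lambda>A. (A, B, C, 2)"] by (auto simp: xy E3C_E_iff inj_def)
  qed
qed

fun corridor :: "e3c_vertex list \<Rightarrow> e3c_vertex set" where
  "corridor (x # y # xs) = leg_hull x y \<union> corridor (y # xs)"
| "corridor [x] = {x}"
| "corridor [] = {}"

fun corridor_length :: "e3c_vertex list \<Rightarrow> nat" where
  "corridor_length (x # y # xs) = leg_length x y + corridor_length (y # xs)"
| "corridor_length _ = 0"

lemma corridor_subset: "set xs \<subseteq> E3C_V r s t \<Longrightarrow> corridor xs \<subseteq> E3C_V r s t"
proof (induction xs rule: corridor.induct)
  case (1 x y xs)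
  then have "x \<in> E3C_V r s t" "y \<in> E3C_V r s t" by auto
  then have "leg_hull x y \<subseteq> E3C_V r s t"
    by (cases x; cases y) (auto dest: interval_subset_tern_words[THEN subsetD, rotated 2])
  then show ?case using 1 by simp
qed auto

lemma hd_in_corridor: "xs \<noteq> [] \<Longrightarrow> successively leg xs \<Longrightarrow> hd xs \<in> corridor xs"
  by (induction xs rule: corridor.induct) auto

lemma last_in_corridor: "xs \<noteq> [] \<Longrightarrow> last xs \<in> corridor xs"
  by (induction xs rule: corridor.induct) auto

lemma gdist_corridor:
  assumes "xs \<noteq> []" "successively leg xs" "corridor xs \<subseteq> S"
  shows "gdist S E3C_E (hd xs) (last xs) \<le> enat (corridor_length xs)"
  using assms
proof (induction xs rule: corridor.induct)
  case (1 x y xs)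
  have "gdist S E3C_E x y \<le> enat (leg_length x y)"
    using gdist_leg[of x y] 1 by (auto intro: gdist_le_mono)
  also have "gdist S E3C_E y (last (y # xs)) \<le> enat (corridor_length (y # xs))"
    using 1 by simp
  finally show ?case by simp
qed (auto intro: gdist_refl)

lemma route_corridor:
  assumes xs: "xs \<noteq> []" "successively leg xs" and "E3C_E u (hd xs)" "E3C_E (last xs) v"
    and "u \<noteq> v" "u \<notin> corridor xs" and "corridor_length xs + 1 < k"
  shows "route E3C_E k u v (corridor xs)"
proof (rule routeI)
  let ?S = "insert v (corridor xs)"
  have "gdist ?S E3C_E (hd xs) (last xs) \<le> enat (corridor_length xs)"
    using xs by (intro gdist_corridor) auto
  also have "gdist ?S E3C_E (last xs) v \<le> enat 1"
    using xs last_in_corridor assms(4) by (intro gdist_edge) auto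
  finally show "gdist ?S E3C_E (hd xs) v \<le> enat (corridor_length xs + 1)" .
qed (use assms hd_in_corridor in auto)

locale e3c_pair =
  fixes r s t :: nat and X Y Z X' Y' Z' :: "nat list"
  assumes words: "X \<in> tern_words r" "Y \<in> tern_words s" "Z \<in> tern_words t"
      "X' \<in> tern_words r" "Y' \<in> tern_words s" "Z' \<in> tern_words t"
begin

abbreviation "V \<equiv> E3C_V r s t"
abbreviation "K \<equiv> r + s + t + 6"
abbreviation "u \<equiv> (X, Y, Z, 2::nat)"
abbreviation "v2 \<equiv> (X', Y', Z', 2::nat)"
abbreviation "v1 \<equiv> (X', Y', Z', 1::nat)"

lemma length_words [simp]:
  "length X = r" "length Y = s" "length Z = t" "length X' = r" "length Y' = s" "length Z' = t"
  using words by (simp_all add: tern_words_length)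

lemmas hamming_bounds =
  hamming_le_tern_words[OF words(1)]
  hamming_le_tern_words[OF words(2)]
  hamming_le_tern_words[OF words(3)]

definition C_detour :: "nat list \<Rightarrow> e3c_vertex set" where
  "C_detour W = corridor [(X, Y, Z, 0), (X, Y, W, 0), (X, Y, W, 2), (X', Y, W, 2), (X', Y, W, 1),
     (X', Y', W, 1), (X', Y', W, 0), (X', Y', Z', 0)]"

definition B_detour :: "nat list \<Rightarrow> e3c_vertex set" where
  "B_detour W = corridor [(X, Y, Z, 1), (X, W, Z, 1), (X, W, Z, 0), (X, W, Z', 0), (X, W, Z', 2),
     (X', W, Z', 2), (X', W, Z', 1), (X', Y', Z', 1)]"

text \<open>Replaces \<open>C_detour\<close> when \<open>X\<close> and \<open>X'\<close> are adjacent: then \<open>carry_corridor X'\<close> already ends in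
  the neighbour \<open>(X', Y', Z', 0)\<close> of the target, and \<open>(X, Y', Z', 2)\<close> is free.\<close>
definition late_C_detour :: "nat list \<Rightarrow> e3c_vertex set" where
  "late_C_detour W = corridor [(X, Y, Z, 0), (X, Y, W, 0), (X, Y, W, 1), (X, Y', W, 1),
     (X, Y', W, 0), (X, Y', Z', 0), (X, Y', Z', 2)]"

lemma route_C_detour:
  assumes "detour_word t Z Z' W" "d \<in> {1, 2}" "u \<noteq> (X', Y', Z', d)"
  shows "route E3C_E K u (X', Y', Z', d) (C_detour W)"
  unfolding C_detour_def using assms hamming_bounds(1)[of X'] hamming_bounds(2)[of Y']
  by (intro route_corridor) (auto simp: detour_word_def E3C_E_iff tern_words_length)

lemma route_B_detour:
  assumes "detour_word s Y Y' W" "u \<noteq> v2"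
  shows "route E3C_E K u v2 (B_detour W)"
  unfolding B_detour_def using assms hamming_bounds(1)[of X'] hamming_bounds(3)[of Z']
  by (intro route_corridor) (auto simp: detour_word_def E3C_E_iff tern_words_length)

lemma route_late_C_detour:
  assumes "detour_word t Z Z' W" "differ_one X X'" "(Y, Z) \<noteq> (Y', Z')"
  shows "route E3C_E K u v2 (late_C_detour W)"
  unfolding late_C_detour_def using assms hamming_bounds(2)[of Y']
  by (intro route_corridor) (auto simp: detour_word_def E3C_E_iff tern_words_length)

lemma C_detour_subset: "detour_word t Z Z' W \<Longrightarrow> C_detour W \<subseteq> V"
  unfolding C_detour_def using words by (intro corridor_subset) (auto simp: detour_word_def)

lemma B_detour_subset: "detour_word s Y Y' W \<Longrightarrow> B_detour W \<subseteq> V"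
  unfolding B_detour_def using words by (intro corridor_subset) (auto simp: detour_word_def)

lemma late_C_detour_subset: "detour_word t Z Z' W \<Longrightarrow> late_C_detour W \<subseteq> V"
  unfolding late_C_detour_def using words by (intro corridor_subset) (auto simp: detour_word_def)

lemma ends_notin_C_detour:
  "detour_word t Z Z' W \<Longrightarrow> d \<in> {1, 2} \<Longrightarrow> {u, (X', Y', Z', d)} \<inter> C_detour W = {}"
  unfolding detour_word_def C_detour_def by auto

lemma ends_notin_B_detour: "detour_word s Y Y' W \<Longrightarrow> {u, v2} \<inter> B_detour W = {}"
  unfolding detour_word_def B_detour_def by auto

lemma ends_notin_late_C_detour:
  "(Y, Z) \<noteq> (Y', Z') \<Longrightarrow> X \<noteq> X' \<Longrightarrow> {u, v2} \<inter> late_C_detour W = {}"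
  unfolding late_C_detour_def by auto

lemma B_detour_C_detour_disjoint:
  "detour_word s Y Y' B \<Longrightarrow> detour_word t Z Z' C \<Longrightarrow> B_detour B \<inter> C_detour C = {}"
  unfolding detour_word_def B_detour_def C_detour_def by auto

lemma B_detour_late_C_detour_disjoint:
  "detour_word s Y Y' B \<Longrightarrow> detour_word t Z Z' C \<Longrightarrow> B_detour B \<inter> late_C_detour C = {}"
  unfolding detour_word_def B_detour_def late_C_detour_def by auto

subsection \<open>Both ends in layer 2\<close>

definition inner_nbrs :: "nat list set" where
  "inner_nbrs = {P \<in> nbrs r X. (P, Y, Z) \<noteq> (X', Y', Z')}"

definition carry_corners :: "nat list \<Rightarrow> e3c_vertex list" where
  "carry_corners P = [(P, Y, Z, 2), (P, Y, Z, 1), (P, Y', Z, 1), (P, Y', Z, 0), (P, Y', Z', 0)]"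

definition carry_corridor :: "nat list \<Rightarrow> e3c_vertex set" where
  "carry_corridor P = corridor (carry_corners P) \<union> fan X X' P \<times> {Y'} \<times> {Z'} \<times> {2}"

lemmas carry_defs = carry_corridor_def carry_corners_def

lemma inner_nbrsD:
  assumes "P \<in> inner_nbrs"
  shows "P \<in> tern_words r" "differ_one X P" "P \<noteq> X" "X \<notin> fan X X' P" "X' \<notin> fan X X' P"
    "P = X' \<or> P \<in> fan X X' P" "(P, Y, Z) \<noteq> (X', Y', Z')"
proof -
  show P: "P \<in> tern_words r" "differ_one X P" "(P, Y, Z) \<noteq> (X', Y', Z')"
    using assms by (auto simp: inner_nbrs_def nbrs_iff)
  show "P \<noteq> X" using P(2) by auto
  show "X \<notin> fan X X' P" "X' \<notin> fan X X' P"
    using P(2) by (simp_all add: source_notin_fan target_notin_fan)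
  show "P = X' \<or> P \<in> fan X X' P" using P(2) neighbour_in_fan[of X X' P] by auto
qed

lemma route_carry_corridor:
  assumes "P \<in> inner_nbrs" "u \<noteq> v2"
  shows "route E3C_E K u v2 (carry_corridor P)"
proof (rule routeI)
  note P = inner_nbrsD[OF assms(1)]
  let ?S = "insert v2 (carry_corridor P)" and ?corners = "carry_corners P"
  have "gdist ?S E3C_E (hd ?corners) (last ?corners) \<le> enat (corridor_length ?corners)"
    by (intro gdist_corridor) (auto simp: carry_defs)
  also have "gdist ?S E3C_E (last ?corners) (P, Y', Z', 2) \<le> enat 1"
    using P by (intro gdist_edge) (auto simp: carry_defs E3C_E_iff)
  also have "gdist ?S E3C_E (P, Y', Z', 2) v2 \<le> enat (hamming P X')"
    by (rule gdist_map[OF gdist_fan[of X X' P], where f = "\<lambda>W. (W, Y', Z', 2)"])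
      (use P in \<open>auto simp: carry_defs E3C_E_iff inj_on_def\<close>)
  finally show "gdist ?S E3C_E (P, Y, Z, 2) v2 \<le> enat (corridor_length ?corners + 1 + hamming P X')"
    by (simp add: carry_corners_def)
  show "corridor_length ?corners + 1 + hamming P X' < K"
    using hamming_bounds(2)[of Y'] hamming_bounds(3)[of Z'] hamming_le_tern_words[OF P(1), of X']
    by (simp add: carry_corners_def)
  show "u \<notin> carry_corridor P" using P by (auto simp: carry_defs)
  show "(P, Y, Z, 2) \<in> carry_corridor P" "E3C_E u (P, Y, Z, 2)"
    using P by (simp_all add: carry_defs E3C_E_iff)
qed (rule assms)

lemma carry_corridor_subset:
  assumes "P \<in> inner_nbrs"
  shows "carry_corridor P \<subseteq> V"
proof -
  note P = inner_nbrsD[OF assms]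
  have "fan X X' P \<subseteq> tern_words r"
    using P fan_subset_interval[of X X' P] interval_subset_tern_words[OF _ words(4), of P] by auto
  moreover have "corridor (carry_corners P) \<subseteq> V"
    using P words by (intro corridor_subset) (auto simp: carry_corners_def)
  ultimately show ?thesis using words by (auto simp: carry_corridor_def)
qed

lemma ends_notin_carry_corridor: "P \<in> inner_nbrs \<Longrightarrow> {u, v2} \<inter> carry_corridor P = {}"
  using inner_nbrsD[of P] by (auto simp: carry_defs)

lemma disjoint_family_carry_corridor: "disjoint_family_on carry_corridor inner_nbrs"
  unfolding disjoint_family_on_def
proof (intro ballI impI)
  fix P Q assume "P \<in> inner_nbrs" "Q \<in> inner_nbrs" "P \<noteq> Q"
  note P = inner_nbrsD[OF \<open>P \<in> inner_nbrs\<close>] and Q = inner_nbrsD[OF \<open>Q \<in> inner_nbrs\<close>]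
  have "fan X X' P \<inter> fan X X' Q = {}"
    using P Q \<open>P \<noteq> Q\<close> by (intro fan_disjoint) auto
  then show "carry_corridor P \<inter> carry_corridor Q = {}"
    using P Q \<open>P \<noteq> Q\<close> by (auto simp: carry_defs)
qed

lemma inner_nbrs_eq: "inner_nbrs = (if E3C_E u v2 then nbrs r X - {X'} else nbrs r X)"
  unfolding inner_nbrs_def using words by (auto simp: E3C_E_iff nbrs_iff)

lemma finite_inner_nbrs: "finite inner_nbrs"
  using finite_nbrs[OF words(1)] by (simp add: inner_nbrs_def)

lemma card_inner_nbrs: "of_bool (E3C_E u v2) + card inner_nbrs = 2 * r"
proof -
  have "X' \<in> nbrs r X" if "E3C_E u v2" using that words by (auto simp: E3C_E_iff nbrs_iff)
  then show ?thesis
    using card_nbrs[OF words(1)] card_Suc_Diff1[OF finite_nbrs[OF words(1)], of X']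
    by (auto simp: inner_nbrs_eq)
qed

lemma linkable_carry_corridors:
  assumes "u \<noteq> v2"
  shows "linkable ({u, v2} \<union> (\<Union>P\<in>inner_nbrs. carry_corridor P)) E3C_E (2 * r) K u v2"
proof -
  have "linkable {u, v2} E3C_E (of_bool (E3C_E u v2)) K u v2"
    using assms by (intro linkable_endpoints) auto
  then have "linkable ({u, v2} \<union> (\<Union>P\<in>inner_nbrs. carry_corridor P)) E3C_E
      (of_bool (E3C_E u v2) + card inner_nbrs) K u v2"
    using finite_inner_nbrs route_carry_corridor ends_notin_carry_corridor
      disjoint_family_carry_corridor assms
    by (intro linkable_add_routes) auto
  then show ?thesis by (simp only: card_inner_nbrs)
qed

lemma carry_B_detour_disjoint:
  assumes "P \<in> inner_nbrs" "detour_word s Y Y' W" "P = X' \<Longrightarrow> Z \<noteq> Z'"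
  shows "carry_corridor P \<inter> B_detour W = {}"
  using assms(2,3) inner_nbrsD[OF assms(1)]
  unfolding carry_defs B_detour_def detour_word_def by auto

lemma carry_C_detour_disjoint:
  assumes "P \<in> inner_nbrs" "detour_word t Z Z' W" "P \<noteq> X'"
  shows "carry_corridor P \<inter> C_detour W = {}"
  using assms(2,3) inner_nbrsD[OF assms(1)]
  unfolding carry_defs C_detour_def detour_word_def by auto

lemma carry_late_C_detour_disjoint:
  assumes "P \<in> inner_nbrs" "detour_word t Z Z' W"
  shows "carry_corridor P \<inter> late_C_detour W = {}"
  using assms(2) inner_nbrsD[OF assms(1)]
  unfolding carry_defs late_C_detour_def detour_word_def by auto

lemma linkable_if_closing_route:
  assumes "u \<noteq> v2" and B: "detour_word s Y Y' B" and no_clash: "X' \<in> inner_nbrs \<Longrightarrow> Z \<noteq> Z'"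
    and S: "S \<subseteq> V" "route E3C_E K u v2 S" "{u, v2} \<inter> S = {}" "B_detour B \<inter> S = {}"
      "\<And>P. P \<in> inner_nbrs \<Longrightarrow> carry_corridor P \<inter> S = {}"
  shows "linkable V E3C_E (2 * r + 2) K u v2"
proof -
  let ?U = "{u, v2} \<union> (\<Union>P\<in>inner_nbrs. carry_corridor P)"
  have "carry_corridor P \<inter> B_detour B = {}" if "P \<in> inner_nbrs" for P
    using that B no_clash by (intro carry_B_detour_disjoint) auto
  then have "linkable (?U \<union> B_detour B) E3C_E (Suc (2 * r)) K u v2"
    using linkable_carry_corridors route_B_detour ends_notin_B_detour B \<open>u \<noteq> v2\<close>
    by (intro linkable_insert_route) auto
  then have "linkable (?U \<union> B_detour B \<union> S) E3C_E (Suc (Suc (2 * r))) K u v2"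
    using S(2)
  proof (rule linkable_insert_route)
    show "(?U \<union> B_detour B) \<inter> S = {}" using S(3-5) unfolding disjoint_iff by blast
  qed simp
  moreover have "?U \<union> B_detour B \<union> S \<subseteq> V"
    using words carry_corridor_subset B_detour_subset[OF B] S(1) by auto
  ultimately show ?thesis by (rule linkable_mono) simp
qed

lemma linkable_u_v2:
  assumes "1 \<le> s" "1 \<le> t" and "u \<noteq> v2"
    and adjacent: "differ_one X X' \<Longrightarrow> Z \<noteq> Z' \<or> E3C_E u v2"
  shows "linkable V E3C_E (2 * r + 2) K u v2"
proof -
  obtain B where B: "detour_word s Y Y' B" using detour_word_exists words(2,5) assms(1) by blast
  obtain C where C: "detour_word t Z Z' C" using detour_word_exists words(3,6) assms(2) by blast
  have no_clash: "Z \<noteq> Z'" if "X' \<in> inner_nbrs"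
    using adjacent inner_nbrsD[OF that] by (auto simp: E3C_E_iff)
  note closing = linkable_if_closing_route[OF \<open>u \<noteq> v2\<close> B no_clash]
  show ?thesis
  proof (cases "differ_one X X' \<and> Z \<noteq> Z'")
    case True
    then have "X \<noteq> X'" by auto
    show ?thesis
    proof (rule closing)
      show "late_C_detour C \<subseteq> V" using C by (rule late_C_detour_subset)
      show "route E3C_E K u v2 (late_C_detour C)" using True C by (intro route_late_C_detour) auto
      show "{u, v2} \<inter> late_C_detour C = {}"
        using True \<open>X \<noteq> X'\<close> by (intro ends_notin_late_C_detour) auto
      show "B_detour B \<inter> late_C_detour C = {}" using B C by (rule B_detour_late_C_detour_disjoint)
    qed (use C carry_late_C_detour_disjoint in auto)
  next
    case False
    then have other_nbr: "P \<noteq> X'" if "P \<in> inner_nbrs" for P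
      using no_clash that inner_nbrsD[OF that] by auto
    show ?thesis
    proof (rule closing)
      show "C_detour C \<subseteq> V" using C by (rule C_detour_subset)
      show "route E3C_E K u v2 (C_detour C)" using C \<open>u \<noteq> v2\<close> by (intro route_C_detour) auto
      show "{u, v2} \<inter> C_detour C = {}" using C by (rule ends_notin_C_detour) simp
      show "B_detour B \<inter> C_detour C = {}" using B C by (rule B_detour_C_detour_disjoint)
    qed (use C other_nbr carry_C_detour_disjoint in auto)
  qed
qed

subsection \<open>Ends in layers 2 and 1\<close>

text \<open>The cases \<open>P = X\<close> and \<open>Q = Y'\<close> stand for the layer changes at the ends.\<close>
definition matched_corridor :: "nat list \<Rightarrow> nat list \<Rightarrow> e3c_vertex set" where
  "matched_corridor P Q = corridor ((if P = X then [] else [(P, Y, Z, 2)]) @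
     [(P, Y, Z, 1), (P, Q, Z, 1), (P, Q, Z, 0), (P, Q, Z', 0), (P, Q, Z', 2), (X', Q, Z', 2)] @
     (if Q = Y' then [] else [(X', Q, Z', 1)]))"

lemma route_matched_corridor:
  assumes "P \<in> closed_nbrs r X" "Q \<in> closed_nbrs s Y'" and "Z \<noteq> Z' \<or> P \<noteq> X' \<and> Q \<noteq> Y"
  shows "route E3C_E K u v1 (matched_corridor P Q)"
proof -
  have "P \<in> tern_words r" "Q \<in> tern_words s" "P = X \<or> differ_one X P" "Q = Y' \<or> differ_one Q Y'"
    using assms words by (auto simp: nbrs_iff dest: differ_one_sym)
  then show ?thesis
    using assms(3) hamming_bounds(2)[of Q] hamming_bounds(3)[of Z'] hamming_le_tern_words[of P r X']
    unfolding matched_corridor_def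
    by (intro route_corridor) (auto simp: E3C_E_iff tern_words_length)
qed

lemma matched_corridor_subset:
  "P \<in> closed_nbrs r X \<Longrightarrow> Q \<in> closed_nbrs s Y' \<Longrightarrow> matched_corridor P Q \<subseteq> V"
  unfolding matched_corridor_def using words by (intro corridor_subset) (auto simp: nbrs_iff)

lemma ends_notin_matched_corridor:
  "Z \<noteq> Z' \<or> P \<noteq> X' \<and> Q \<noteq> Y \<Longrightarrow> {u, v1} \<inter> matched_corridor P Q = {}"
  unfolding matched_corridor_def by auto

lemma matched_corridor_disjoint:
  assumes "P \<noteq> P'" "Q \<noteq> Q'"
    and "Z \<noteq> Z' \<or> P \<noteq> X' \<and> Q \<noteq> Y" "Z \<noteq> Z' \<or> P' \<noteq> X' \<and> Q' \<noteq> Y"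
  shows "matched_corridor P Q \<inter> matched_corridor P' Q' = {}"
  using assms unfolding matched_corridor_def by auto

lemma matched_C_detour_disjoint:
  assumes "detour_word t Z Z' W" "(P, Q) \<noteq> (X, Y)" "(P, Q) \<noteq> (X', Y')"
  shows "matched_corridor P Q \<inter> C_detour W = {}"
  using assms unfolding matched_corridor_def C_detour_def detour_word_def by auto

definition matched_region :: "(nat list \<times> nat list) set \<Rightarrow> nat list \<Rightarrow> e3c_vertex set" where
  "matched_region M W = {u, v1} \<union> (\<Union>(P, Q)\<in>M. matched_corridor P Q) \<union> C_detour W"

lemma matched_region_subset:
  assumes M: "matching (closed_nbrs r X) (closed_nbrs s Y') k M" and W: "detour_word t Z Z' W"
  shows "matched_region M W \<subseteq> V"
proof -
  have "matched_corridor P Q \<subseteq> V" if "(P, Q) \<in> M" for P Q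
    using that M by (intro matched_corridor_subset) (auto simp: matching_def)
  then show ?thesis using words C_detour_subset[OF W] by (auto simp: matched_region_def)
qed

lemma linkable_matched_region:
  assumes M: "matching (closed_nbrs r X) (closed_nbrs s Y') k M" "M \<inter> {(X, Y), (X', Y')} = {}"
    and separated: "\<And>P Q. (P, Q) \<in> M \<Longrightarrow> Z \<noteq> Z' \<or> P \<noteq> X' \<and> Q \<noteq> Y"
    and W: "detour_word t Z Z' W"
  shows "linkable (matched_region M W) E3C_E (of_bool (E3C_E u v1) + k + 1) K u v1"
proof -
  let ?U = "{u, v1} \<union> (\<Union>(P, Q)\<in>M. matched_corridor P Q)"
  have M_props: "M \<subseteq> closed_nbrs r X \<times> closed_nbrs s Y'" "finite M" "card M = k"
    using M(1) by (auto simp: matching_def)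
  have disjoint: "matched_corridor P Q \<inter> matched_corridor P' Q' = {}"
    if "(P, Q) \<in> M" "(P', Q') \<in> M" "(P, Q) \<noteq> (P', Q')" for P Q P' Q'
    using matching_disjoint_coordinates[OF M(1) that] separated that
    by (intro matched_corridor_disjoint) blast+
  have "linkable ?U E3C_E (of_bool (E3C_E u v1) + card M) K u v1"
  proof (rule linkable_add_routes)
    show "linkable {u, v1} E3C_E (of_bool (E3C_E u v1)) K u v1" by (rule linkable_endpoints) auto
    show "disjoint_family_on (\<lambda>(P, Q). matched_corridor P Q) M"
      unfolding disjoint_family_on_def using disjoint by blast
  qed (use M_props separated route_matched_corridor ends_notin_matched_corridor in auto)
  then have "linkable (?U \<union> C_detour W) E3C_E (Suc (of_bool (E3C_E u v1) + card M)) K u v1"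
  proof (rule linkable_insert_route)
    show "route E3C_E K u v1 (C_detour W)" using W by (rule route_C_detour) auto
    have "{u, v1} \<inter> C_detour W = {}" using W by (rule ends_notin_C_detour) simp
    moreover have "matched_corridor P Q \<inter> C_detour W = {}" if "(P, Q) \<in> M" for P Q
      using that W M(2) by (intro matched_C_detour_disjoint) auto
    ultimately show "?U \<inter> C_detour W = {}" unfolding disjoint_iff by fast
  qed simp
  then show ?thesis by (simp add: matched_region_def M_props(3))
qed

lemma linkable_u_v1_separated:
  assumes m: "1 \<le> m" "m \<le> r" "m \<le> s" and "1 \<le> t"
    and separated: "Z \<noteq> Z' \<or> X' \<notin> closed_nbrs r X \<and> Y \<notin> closed_nbrs s Y'"
  shows "linkable V E3C_E (2 * m + 2) K u v1"
proof -
  obtain W where W: "detour_word t Z Z' W" using detour_word_exists words(3,6) \<open>1 \<le> t\<close> by blast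
  let ?F = "{(X, Y), (X', Y')}"
  have "2 * m + 1 \<le> card (closed_nbrs r X)" "2 * m + 1 \<le> card (closed_nbrs s Y')"
    using m card_closed_nbrs[OF words(1)] card_closed_nbrs[OF words(5)] by simp_all
  moreover have "finite ?F" "card ?F < 2 * m + 1" using m(1) by (simp_all add: card_insert_if)
  ultimately obtain M where M: "matching (closed_nbrs r X) (closed_nbrs s Y') (2 * m + 1) M"
    "M \<inter> ?F = {}"
    by (rule matching_avoiding)
  then have "Z \<noteq> Z' \<or> P \<noteq> X' \<and> Q \<noteq> Y" if "(P, Q) \<in> M" for P Q
    using that separated unfolding matching_def by blast
  with M have "linkable (matched_region M W) E3C_E (of_bool (E3C_E u v1) + (2 * m + 1) + 1) K u v1"
    using W by (rule linkable_matched_region)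
  then show ?thesis using matched_region_subset[OF M(1) W] by (rule linkable_mono) simp
qed

definition direct_corridor :: "e3c_vertex set" where
  "direct_corridor = corridor ((if X = X' then [] else [(X', Y, Z, 2)]) @
     (if Y = Y' then [] else [(X', Y, Z, 1), (X', toward Y' Y, Z, 1)]))"

lemma route_direct_corridor:
  assumes "Z = Z'" "X' \<in> closed_nbrs r X" "\<not> E3C_E u v1"
  shows "route E3C_E K u v1 direct_corridor"
proof -
  have "X' = X \<or> differ_one X X'" "Y = Y' \<or> differ_one (toward Y' Y) Y'" "X \<noteq> X' \<or> Y \<noteq> Y'"
    using assms differ_one_toward[of Y' Y] by (auto simp: nbrs_iff E3C_E_iff dest: differ_one_sym)
  then show ?thesis
    using assms(1) hamming_bounds(2)[of "toward Y' Y"]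
    unfolding direct_corridor_def by (intro route_corridor) (auto simp: E3C_E_iff)
qed

lemma direct_corridor_subset: "direct_corridor \<subseteq> V"
  unfolding direct_corridor_def using words toward_in_closed_nbrs[of Y' s Y]
  by (intro corridor_subset) (auto simp: nbrs_iff)

lemma matched_direct_disjoint:
  assumes "P \<noteq> X'" "Q \<in> closed_nbrs s Y'" "Q \<noteq> toward Y' Y"
  shows "matched_corridor P Q \<inter> direct_corridor = {}"
proof -
  have "Q \<notin> interval Y (toward Y' Y)"
    using interval_inter_ball_toward[of Y' Y Q] assms(2,3) by (auto simp: nbrs_iff)
  moreover from this have "Q \<noteq> Y" by auto
  ultimately show ?thesis using assms(1) unfolding matched_corridor_def direct_corridor_def by auto
qed

lemma ends_notin_direct_corridor: "{u, v1} \<inter> direct_corridor = {}"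
proof -
  have "Y' \<notin> interval Y (toward Y' Y)" if "Y \<noteq> Y'"
    using that interval_inter_ball_toward[of Y' Y Y'] differ_one_toward[of Y' Y] by auto
  then show ?thesis unfolding direct_corridor_def by auto
qed

lemma C_detour_direct_disjoint:
  "Z = Z' \<Longrightarrow> detour_word t Z Z' W \<Longrightarrow> C_detour W \<inter> direct_corridor = {}"
  unfolding C_detour_def direct_corridor_def detour_word_def by auto

lemma matching_closed_nbrs_minus:
  assumes m: "1 \<le> m" "m \<le> r" "m \<le> s" and "X' \<in> closed_nbrs r X"
  obtains M where
    "matching (closed_nbrs r X - {X'}) (closed_nbrs s Y' - {toward Y' Y}) (2 * m) M"
proof -
  let ?A = "closed_nbrs r X - {X'}" and ?B = "closed_nbrs s Y' - {toward Y' Y}"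
  have "2 * m \<le> card ?A" "2 * m \<le> card ?B"
    using assms toward_in_closed_nbrs[OF words(5,2)] card_closed_nbrs[OF words(1)]
      card_closed_nbrs[OF words(5)]
    by (simp_all add: card_Diff_singleton)
  moreover have "card ({} :: (nat list \<times> nat list) set) < 2 * m" using m(1) by simp
  ultimately show ?thesis using that by (rule matching_avoiding[OF _ _ finite.emptyI])
qed

lemma linkable_u_v1_close:
  assumes m: "1 \<le> m" "m \<le> r" "m \<le> s" and "1 \<le> t" and close: "Z = Z'" "X' \<in> closed_nbrs r X"
  shows "linkable V E3C_E (2 * m + 2) K u v1"
proof -
  obtain W where W: "detour_word t Z Z' W" using detour_word_exists words(3,6) \<open>1 \<le> t\<close> by blast
  obtain M where M: "matching (closed_nbrs r X - {X'}) (closed_nbrs s Y' - {toward Y' Y}) (2 * m) M"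
    using matching_closed_nbrs_minus m close(2) by blast
  have inner: "P \<noteq> X'" "Q \<in> closed_nbrs s Y'" "Q \<noteq> toward Y' Y" "Q \<noteq> Y" if "(P, Q) \<in> M" for P Q
    using that M interval_inter_ball_toward[of Y' Y Y] by (auto simp: matching_def nbrs_iff)
  have M': "matching (closed_nbrs r X) (closed_nbrs s Y') (2 * m) M"
    using M by (rule matching_mono) auto
  have region: "linkable (matched_region M W) E3C_E (of_bool (E3C_E u v1) + 2 * m + 1) K u v1"
    using M' _ _ W by (rule linkable_matched_region) (use inner in blast)+
  have subset: "matched_region M W \<subseteq> V" using M' W by (rule matched_region_subset)
  show ?thesis
  proof (cases "E3C_E u v1")
    case True
    show ?thesis using region subset by (rule linkable_mono) (use True in simp)
  next
    case False
    have "linkable (matched_region M W \<union> direct_corridor) E3C_E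
        (Suc (of_bool (E3C_E u v1) + 2 * m + 1)) K u v1"
      using region route_direct_corridor[OF close False]
    proof (rule linkable_insert_route)
      have "matched_corridor P Q \<inter> direct_corridor = {}" if "(P, Q) \<in> M" for P Q
        using inner[OF that] by (intro matched_direct_disjoint)
      then show "matched_region M W \<inter> direct_corridor = {}"
        using ends_notin_direct_corridor C_detour_direct_disjoint[OF close(1) W]
        unfolding matched_region_def disjoint_iff by fast
    qed (simp add: matched_region_def)
    then show ?thesis using subset direct_corridor_subset
      by (rule linkable_mono[OF _ Un_least]) (use False in simp)
  qed
qed

end

subsection \<open>Symmetries\<close>

definition swap_AB :: "e3c_vertex \<Rightarrow> e3c_vertex" where
  "swap_AB = (\<lambda>(A, B, C, d). (B, A, C, Transposition.transpose 1 2 d))"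

lemma swap_AB_swap_AB [simp]: "swap_AB (swap_AB x) = x"
  by (simp add: swap_AB_def split: prod.split)

lemma inj_swap_AB: "inj swap_AB"
  by (rule inj_on_inverseI[of _ swap_AB]) simp

lemma swap_AB_in_E3C_V: "x \<in> E3C_V r s t \<Longrightarrow> swap_AB x \<in> E3C_V s r t"
  by (cases x) (auto simp: swap_AB_def Transposition.transpose_def)

lemma linkable_swap_AB:
  assumes "linkable (E3C_V s r t) E3C_E n k (swap_AB u) (swap_AB v)"
  shows "linkable (E3C_V r s t) E3C_E n k u v"
  using assms
proof (rule linkable_involution)
  show "swap_AB ` E3C_V s r t \<subseteq> E3C_V r s t" using swap_AB_in_E3C_V by blast
  show "E3C_E (swap_AB x) (swap_AB y)" if "E3C_E x y" for x y
    using that by (cases x; cases y) (auto simp: swap_AB_def E3C_E_iff Transposition.transpose_def)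
qed simp

definition swap_BC :: "e3c_vertex \<Rightarrow> e3c_vertex" where
  "swap_BC = (\<lambda>(A, B, C, d). (A, C, B, Transposition.transpose 0 1 d))"

lemma swap_BC_swap_BC [simp]: "swap_BC (swap_BC x) = x"
  by (simp add: swap_BC_def split: prod.split)

lemma inj_swap_BC: "inj swap_BC"
  by (rule inj_on_inverseI[of _ swap_BC]) simp

lemma swap_BC_in_E3C_V: "x \<in> E3C_V r s t \<Longrightarrow> swap_BC x \<in> E3C_V r t s"
  by (cases x) (auto simp: swap_BC_def Transposition.transpose_def)

lemma linkable_swap_BC:
  assumes "linkable (E3C_V r t s) E3C_E n k (swap_BC u) (swap_BC v)"
  shows "linkable (E3C_V r s t) E3C_E n k u v"
  using assms
proof (rule linkable_involution)
  show "swap_BC ` E3C_V r t s \<subseteq> E3C_V r s t" using swap_BC_in_E3C_V by blast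
  show "E3C_E (swap_BC x) (swap_BC y)" if "E3C_E x y" for x y
    using that by (cases x; cases y) (auto simp: swap_BC_def E3C_E_iff Transposition.transpose_def)
qed simp

lemma linkable_layers_2_2:
  assumes "1 \<le> s" "1 \<le> t" and "(A, B, C, 2) \<in> E3C_V r s t" "(A', B', C', 2) \<in> E3C_V r s t"
    and "(A, B, C, 2) \<noteq> (A', B', C', 2::nat)"
  shows "linkable (E3C_V r s t) E3C_E (2 * r + 2) (r + s + t + 6) (A, B, C, 2) (A', B', C', 2)"
proof (cases "C \<noteq> C' \<or> B = B'")
  case True
  interpret e3c_pair r s t A B C A' B' C' using assms by unfold_locales auto
  show ?thesis using assms(1,2,5) True by (intro linkable_u_v2) (auto simp: E3C_E_iff)
next
  case False
  interpret e3c_pair r t s A C B A' C' B' using assms by unfold_locales auto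
  have swapped:
    "linkable (E3C_V r t s) E3C_E (2 * r + 2) (r + t + s + 6) (A, C, B, 2) (A', C', B', 2)"
    using assms(1,2,5) False by (intro linkable_u_v2) auto
  show ?thesis by (rule linkable_swap_BC) (use swapped in \<open>simp add: swap_BC_def add_ac\<close>)
qed

lemma linkable_layers_2_1:
  assumes m: "1 \<le> m" "m \<le> r" "m \<le> s" "m \<le> t"
    and "(A, B, C, 2) \<in> E3C_V r s t" "(A', B', C', 1) \<in> E3C_V r s t"
  shows "linkable (E3C_V r s t) E3C_E (2 * m + 2) (r + s + t + 6) (A, B, C, 2) (A', B', C', 1)"
proof -
  interpret e3c_pair r s t A B C A' B' C' using assms by unfold_locales auto
  interpret rev: e3c_pair s r t B' A' C' B A C using assms by unfold_locales auto
  consider (separated) "C \<noteq> C' \<or> A' \<notin> closed_nbrs r A \<and> B \<notin> closed_nbrs s B'"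
    | (close) "C = C'" "A' \<in> closed_nbrs r A" | (close_rev) "C' = C" "B \<in> closed_nbrs s B'"
    by blast
  then show ?thesis
  proof cases
    case separated
    then show ?thesis using m by (intro linkable_u_v1_separated) auto
  next
    case close
    then show ?thesis using m by (intro linkable_u_v1_close) auto
  next
    case close_rev
    then have swapped:
      "linkable (E3C_V s r t) E3C_E (2 * m + 2) (s + r + t + 6) (B', A', C', 2) (B, A, C, 1)"
      using m by (intro rev.linkable_u_v1_close) auto
    have "linkable (E3C_V r s t) E3C_E (2 * m + 2) (r + s + t + 6) (A', B', C', 1) (A, B, C, 2)"
      by (rule linkable_swap_AB) (use swapped in \<open>simp add: swap_AB_def add_ac\<close>)
    then show ?thesis using symp_E3C_E by (rule linkable_sym)
  qed
qed

lemma linkable_from_layer_2: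
  assumes "1 \<le> m" "m \<le> r" "m \<le> s" "m \<le> t"
    and "(A, B, C, 2) \<in> E3C_V r s t" and "v \<in> E3C_V r s t" and "(A, B, C, 2) \<noteq> v"
  shows "linkable (E3C_V r s t) E3C_E (2 * m + 2) (r + s + t + 6) (A, B, C, 2) v"
proof -
  obtain A' B' C' d where v_eq: "v = (A', B', C', d)" by (cases v)
  consider (layer_2) "d = 2" | (layer_1) "d = 1" | (layer_0) "d = 0"
    using assms(6) by (auto simp: v_eq)
  then show ?thesis
  proof cases
    case layer_2
    have "linkable (E3C_V r s t) E3C_E (2 * r + 2) (r + s + t + 6) (A, B, C, 2) v"
      using assms unfolding v_eq layer_2 by (intro linkable_layers_2_2) auto
    then show ?thesis using assms(2) by (auto intro: linkable_mono)
  next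
    case layer_1
    show ?thesis using assms unfolding v_eq layer_1 by (intro linkable_layers_2_1) auto
  next
    case layer_0
    have swapped:
      "linkable (E3C_V r t s) E3C_E (2 * m + 2) (r + t + s + 6) (A, C, B, 2) (A', C', B', 1)"
      using assms unfolding v_eq layer_0 by (intro linkable_layers_2_1) auto
    show ?thesis unfolding v_eq layer_0
      by (rule linkable_swap_BC) (use swapped in \<open>simp add: swap_BC_def add_ac\<close>)
  qed
qed

lemma linkable_from_layer_1:
  assumes "1 \<le> m" "m \<le> r" "m \<le> s" "m \<le> t"
    and "(A, B, C, 1) \<in> E3C_V r s t" "v \<in> E3C_V r s t" "(A, B, C, 1) \<noteq> v"
  shows "linkable (E3C_V r s t) E3C_E (2 * m + 2) (r + s + t + 6) (A, B, C, 1) v"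
proof (rule linkable_swap_AB)
  have swap_u: "swap_AB (A, B, C, 1) = (B, A, C, 2)" by (simp add: swap_AB_def)
  moreover have "swap_AB (A, B, C, 1) \<noteq> swap_AB v"
    using assms(7) by (simp add: inj_eq[OF inj_swap_AB])
  ultimately have
    "linkable (E3C_V s r t) E3C_E (2 * m + 2) (s + r + t + 6) (B, A, C, 2) (swap_AB v)"
    using assms swap_AB_in_E3C_V[OF assms(6)] by (intro linkable_from_layer_2) auto
  then show "linkable (E3C_V s r t) E3C_E (2 * m + 2) (r + s + t + 6)
      (swap_AB (A, B, C, 1)) (swap_AB v)"
    unfolding swap_u by (simp only: add_ac)
qed

lemma linkable_from_layer_0:
  assumes "1 \<le> m" "m \<le> r" "m \<le> s" "m \<le> t"
    and "(A, B, C, 0) \<in> E3C_V r s t" "v \<in> E3C_V r s t" "(A, B, C, 0) \<noteq> v"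
  shows "linkable (E3C_V r s t) E3C_E (2 * m + 2) (r + s + t + 6) (A, B, C, 0) v"
proof (rule linkable_swap_BC)
  have swap_u: "swap_BC (A, B, C, 0) = (A, C, B, 1)" by (simp add: swap_BC_def)
  moreover have "swap_BC (A, B, C, 0) \<noteq> swap_BC v"
    using assms(7) by (simp add: inj_eq[OF inj_swap_BC])
  ultimately have
    "linkable (E3C_V r t s) E3C_E (2 * m + 2) (r + t + s + 6) (A, C, B, 1) (swap_BC v)"
    using assms swap_BC_in_E3C_V[OF assms(6)] by (intro linkable_from_layer_1) auto
  then show "linkable (E3C_V r t s) E3C_E (2 * m + 2) (r + s + t + 6)
      (swap_BC (A, B, C, 0)) (swap_BC v)"
    unfolding swap_u by (simp only: add_ac)
qed

theorem linkable_E3C: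
  assumes "1 \<le> m" "m \<le> r" "m \<le> s" "m \<le> t"
    and "u \<in> E3C_V r s t" "v \<in> E3C_V r s t" "u \<noteq> v"
  shows "linkable (E3C_V r s t) E3C_E (2 * m + 2) (r + s + t + 6) u v"
proof -
  obtain A B C d where u_eq: "u = (A, B, C, d)" by (cases u)
  consider (layer_2) "d = 2" | (layer_1) "d = 1" | (layer_0) "d = 0"
    using assms(5) by (auto simp: u_eq)
  then show ?thesis
  proof cases
    case layer_2
    show ?thesis using assms unfolding u_eq layer_2 by (rule linkable_from_layer_2)
  next
    case layer_1
    show ?thesis using assms unfolding u_eq layer_1 by (rule linkable_from_layer_1)
  next
    case layer_0
    show ?thesis using assms unfolding u_eq layer_0 by (rule linkable_from_layer_0)
  qed
qed

section \<open>The lower bound\<close>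

text \<open>The summand that is added to the Hamming distances counts the layer changes that are still
  needed on the way to \<open>(A', B', C', 2)\<close>.\<close>
fun potential :: "nat list \<Rightarrow> nat list \<Rightarrow> nat list \<Rightarrow> e3c_vertex \<Rightarrow> nat" where
  "potential A' B' C' (A, B, C, d) = hamming A A' + hamming B B' + hamming C C' +
     (if d = 2 then (if B = B' \<and> C = C' then 0 else if B = B' \<or> C = C' then 2 else 3)
      else if d = 1 then (if C = C' then 1 else 2)
      else (if B = B' then 1 else 2))"

lemma potential_le_Suc:
  assumes "E3C_E x y" "x \<in> E3C_V r s t" "y \<in> E3C_V r s t"
    and words: "A' \<in> tern_words r" "B' \<in> tern_words s" "C' \<in> tern_words t"
  shows "potential A' B' C' x \<le> potential A' B' C' y + 1"
proof -
  obtain A B C d A1 B1 C1 d1 where xy: "x = (A, B, C, d)" "y = (A1, B1, C1, d1)"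
    by (cases x; cases y)
  have "length A' = length A1" "length B' = length B1" "length C' = length C1"
    using assms(3) words by (auto simp: xy tern_words_length)
  note hamming = this[THEN hamming_differ_one[rotated]]
  from assms(1) consider "A = A1" "B = B1" "C = C1"
    | "d = 0" "d1 = 0" "A = A1" "B = B1" "differ_one C C1"
    | "d = 1" "d1 = 1" "A = A1" "C = C1" "differ_one B B1"
    | "d = 2" "d1 = 2" "B = B1" "C = C1" "differ_one A A1"
    unfolding xy E3C_E_iff by blast
  then show ?thesis
    by cases (use assms(2,3) hamming in \<open>auto simp: xy\<close>)
qed

lemma neighbours_layer_2:
  assumes "(A, B, C, 2) \<in> E3C_V r s t"
  shows "neighbours (E3C_V r s t) E3C_E (A, B, C, 2) =
    (\<lambda>P. (P, B, C, 2)) ` nbrs r A \<union> {(A, B, C, 0), (A, B, C, 1)}"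
  using assms by (auto simp: neighbours_def E3C_E_iff)

lemma
  assumes "(A, B, C, 2) \<in> E3C_V r s t"
  shows finite_neighbours_layer_2: "finite (neighbours (E3C_V r s t) E3C_E (A, B, C, 2))"
    and card_neighbours_layer_2: "card (neighbours (E3C_V r s t) E3C_E (A, B, C, 2)) = 2 * r + 2"
proof -
  have "finite (nbrs r A)" "card (nbrs r A) = 2 * r"
    using assms finite_nbrs card_nbrs by auto
  then show "finite (neighbours (E3C_V r s t) E3C_E (A, B, C, 2))"
    "card (neighbours (E3C_V r s t) E3C_E (A, B, C, 2)) = 2 * r + 2"
    unfolding neighbours_layer_2[OF assms]
    by (auto simp: card_image inj_on_def card_insert_if)
qed

lemma potential_le_gdist:
  assumes "A' \<in> tern_words r" "B' \<in> tern_words s" "C' \<in> tern_words t"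
  shows "enat (potential A' B' C' x) \<le> gdist (E3C_V r s t) E3C_E x (A', B', C', 2)"
proof -
  have "enat (potential A' B' C' x - potential A' B' C' (A', B', C', 2))
      \<le> gdist (E3C_V r s t) E3C_E x (A', B', C', 2)"
    by (rule gdist_ge_potential) (rule potential_le_Suc[OF _ _ _ assms])
  then show ?thesis by simp
qed

theorem fault_diam_E3C_ge:
  assumes "1 \<le> r" "1 \<le> s" "1 \<le> t"
  shows "enat (r + s + t + 4) \<le> fault_diam (E3C_V r s t) E3C_E (2 * r + 1)"
proof -
  let ?V = "E3C_V r s t"
  let ?zeros = "\<lambda>k. replicate k (0::nat)" and ?ones = "\<lambda>k. replicate k (1::nat)"
  obtain r' where r: "r = Suc r'" using assms(1) by (cases r) auto
  define u where "u = (?zeros r, ?zeros s, ?zeros t, 2::nat)"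
  define v where "v = (?ones r, ?ones s, ?ones t, 2::nat)"
  define w where "w = (2 # ?zeros r', ?zeros s, ?zeros t, 2::nat)"
  have vertices: "u \<in> ?V" "v \<in> ?V" "w \<in> ?V"
    by (auto simp: u_def v_def w_def r tern_words_def)
  have differ: "?zeros s \<noteq> ?ones s" "?zeros t \<noteq> ?ones t"
    using assms by (auto dest: arg_cong[of _ _ hd])
  have "potential (?ones r) (?ones s) (?ones t) w = r + s + t + 3"
    using differ by (simp add: w_def r hamming_replicate)
  then have "enat (r + s + t + 3) \<le> gdist ?V E3C_E w v"
    using vertices(2) potential_le_gdist[of "?ones r" r "?ones s" s "?ones t" t w]
    by (simp add: v_def)
  then have "enat (Suc (r + s + t + 3)) \<le> fault_diam ?V E3C_E (card (neighbours ?V E3C_E u) - 1)"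
  proof (rule fault_diam_ge_isolating[OF vertices(1,2), rotated -1])
    show "u \<noteq> v" "\<not> E3C_E u u" "\<not> E3C_E u v" using differ by (simp_all add: u_def v_def E3C_E_iff)
    show "finite (neighbours ?V E3C_E u)"
      using vertices(1) finite_neighbours_layer_2 by (simp add: u_def)
    show "w \<in> neighbours ?V E3C_E u"
      using vertices(3) by (simp add: neighbours_def u_def w_def r E3C_E_iff)
  qed
  then show ?thesis using vertices(1) card_neighbours_layer_2 by (simp add: u_def ac_simps)
qed

theorem theorem3:
  fixes r s t n :: nat
  assumes "1 \<le> r" and "r \<le> s" and "s \<le> t" and "n = r + s + t + 1"
  shows "enat (n + 3) = enat (r + s + t + 4)
       \<and> enat (r + s + t + 4) \<le> fault_diam (E3C_V r s t) E3C_E (2 * r + 1)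
       \<and> fault_diam (E3C_V r s t) E3C_E (2 * r + 1) \<le> wide_diam (E3C_V r s t) E3C_E (2 * r + 2)
       \<and> wide_diam (E3C_V r s t) E3C_E (2 * r + 2) \<le> enat (r + s + t + 6)
       \<and> enat (r + s + t + 6) = enat (n + 5)"
proof -
  have "enat (r + s + t + 4) \<le> fault_diam (E3C_V r s t) E3C_E (2 * r + 1)"
    using assms by (intro fault_diam_E3C_ge) auto
  moreover have "fault_diam (E3C_V r s t) E3C_E (2 * r + 1)
      \<le> wide_diam (E3C_V r s t) E3C_E (2 * r + 2)"
    by (rule fault_diam_le_wide_diam) simp
  moreover have "wide_diam (E3C_V r s t) E3C_E (2 * r + 2) \<le> enat (r + s + t + 6)"
    using assms by (intro wide_diam_le linkable_E3C) auto
  ultimately show ?thesis using assms(4) by auto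
qed

end
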